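(* Let $(X_1,X_2,X_3)$ have standard exponential margins and joint density $f$ given by the trivariate vine copula in which $C_{12}$ and $C_{23}$ are extreme value copulas with exponent measures $V^{\{12\}},V^{\{23\}}$, and $C_{13|2}$ is an inverted extreme value copula with exponent measure $V^{\{13|2\}}$. Assume the spectral densities satisfy the tail conditions in the context. Then the gauge function of $f$ is, for $\min(x_1,x_2,x_3)\ge0$, (i) if $\max(x_1,x_3)<x_2$: $$g(\mathbf x)=x_2+\left(2+s_{\rm m}^{\{13|2\}}\right)\max\left\{\left(1+s_2^{\{12\}}\right)(x_2-x_1),\left(1+s_1^{\{23\}}\right)(x_2-x_3)\right\}-\left(1+s_{\rm m}^{\{13|2\}}\right)\min\left\{\left(1+s_2^{\{12\}}\right)(x_2-x_1),\left(1+s_1^{\{23\}}\right)(x_2-x_3)\right\},$$ where $s_{\rm m}^{\{13|2\}}=s_1^{\{13|2\}}$ if $(1+s_2^{\{12\}})(x_2-x_1)\ge(1+s_1^{\{23\}})(x_2-x_3)$ and $s_{\rm m}^{\{13|2\}}=s_2^{\{13|2\}}$ otherwise; (ii) if $x_1<x_2\le x_3$: $g(\mathbf x)=x_2+\left(2+s_1^{\{13|2\}}\right)\left(1+s_2^{\{12\}}\right)(x_2-x_1)+\left(2+s_2^{\{23\}}\right)(x_3-x_2)$; (iii) if $x_3<x_2\le x_1$: $g(\mathbf x)=x_2+\left(2+s_2^{\{13|2\}}\right)\left(1+s_1^{\{23\}}\right)(x_2-x_3)+\left(2+s_1^{\{12\}}\right)(x_1-x_2)$; (iv) if $x_2\le\min(x_1,x_3)$: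 $g(\mathbf x)=x_2+V^{\{13|2\}}\left[\left\{\left(2+s_1^{\{12\}}\right)(x_1-x_2)\right\}^{-1},\left\{\left(2+s_2^{\{23\}}\right)(x_3-x_2)\right\}^{-1}\right]$. Moreover, the coefficients of tail dependence satisfy $\eta_{\{1,2,3\}}=1$ and $\eta_{\{1,3\}}=1$.
   Context: The gauge function of $f$ is the function $g$, homogeneous of order 1, with $-\ln f(t\mathbf x)\sim tg(\mathbf x)$ as $t\to\infty$, where $\mathbf x=(x_1,x_2,x_3)$. For $\mathcal C\subseteq\{1,2,3\}$, $|\mathcal C|\ge2$, the coefficient of tail dependence $\eta_{\mathcal C}\in(0,1]$ is defined by $\Pr(X_i>x:i\in\mathcal C)\sim L_{\mathcal C}(e^x)e^{-x/\eta_{\mathcal C}}$ as $x\to\infty$, with $L_{\mathcal C}$ slowly varying at infinity; it is obtained from the gauge function through $\eta_{\mathcal C}=\{\min g(\mathbf x)\}^{-1}$, the minimum being over $x_i\ge1$ for $i\in\mathcal C$ and $x_i\ge0$ for $i\notin\mathcal C$. Exponent measure: $V(x,y)=2\int_0^1\max\left(\frac wx,\frac{1-w}{y}\right)dH(w)$, $x,y>0$, where the spectral distribution $H$ is a probability distribution on $[0,1]$ with $\int_0^1w\,dH(w)=1/2$. The derivatives of $V$ with respect to the first, second and both arguments are assumed to exist. Reciprocals of $0$ are read as $\infty$, with $V$ then evaluated by the same integral. Tail conditions: $h^{\{12\}},h^{\{23\}},h^{\{13|2\}}$ denote the spectral densities (densities of $H$) of the three pair copula components; they place no mass on $\{0\}$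 or $\{1\}$, and each satisfies $h^{\{\cdot\}}(w)\sim c_1^{\{\cdot\}}(1-w)^{s_1^{\{\cdot\}}}$ as $w\nearrow1$ and $h^{\{\cdot\}}(w)\sim c_2^{\{\cdot\}}w^{s_2^{\{\cdot\}}}$ as $w\searrow0$, for some $c_1^{\{\cdot\}},c_2^{\{\cdot\}}\in\mathbb{R}$ and $s_1^{\{\cdot\}},s_2^{\{\cdot\}}>-1$. Extreme value copula: $C(u,v)=\exp\left\{-V\left(\frac{-1}{\ln u},\frac{-1}{\ln v}\right)\right\}$. Inverted extreme value copula: $C(u,v)=u+v-1+\exp\left[-V\left\{\frac{-1}{\ln(1-u)},\frac{-1}{\ln(1-v)}\right\}\right]$. Density $c=\partial^2C/\partial u\,\partial v$. Trivariate vine: with $F_i(x)=1-e^{-x}$, $f_i(x)=e^{-x}$, $F_{1|2}(x_1|x_2)=\partial_2C_{12}\{F_1(x_1),F_2(x_2)\}$, $F_{3|2}(x_3|x_2)=\partial_1C_{23}\{F_2(x_2),F_3(x_3)\}$, $$f(\mathbf x)=f_1(x_1)f_2(x_2)f_3(x_3)\,c_{12}\{F_1(x_1),F_2(x_2)\}\,c_{23}\{F_2(x_2),F_3(x_3)\}\,c_{13|2}\{F_{1|2}(x_1|x_2),F_{3|2}(x_3|x_2)\}.$$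
   Formalization: Added: each spectral density is bounded and bounded away from 0 on compact subintervals of (0,1) (else false, e.g. h^{12}=0 near 1/2 on x_1=x_2), and c_1,c_2 are nonzero; the limit defining g is required for positive x only, with g continued continuously to the boundary. *)

theory Defs
  imports "HOL-Probability.Probability" "HOL-Library.Landau_Symbols"
begin

section \<open>Spectral distributions and exponent measures\<close>

definition spectral_distribution :: "real measure \<Rightarrow> bool" where
  "spectral_distribution H \<longleftrightarrow>
     prob_space H \<and> sets H = sets borel \<and> emeasure H (- {0..1}) = 0 \<and> (\<integral>w. w \<partial>H) = 1 / 2"

definition exponent_measure :: "real measure \<Rightarrow> real \<Rightarrow> real \<Rightarrow> real" where
  "exponent_measure H x y = 2 * (LINT w:{0..1}|H. max (w / x) ((1 - w) / y))"

text \<open>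
  The only non-finite arguments that occur are reciprocals of 0, where the terms
  w / x or (1 - w) / y have to vanish. As inverse 0 = 0 and division by 0
  gives 0, the real-valued definition already has the intended value there:
\<close>

lemma exponent_measure_inverse:
  "exponent_measure H (inverse a) (inverse b) = 2 * (LINT w:{0..1}|H. max (w * a) ((1 - w) * b))"
  by (simp add: exponent_measure_def divide_inverse)

definition has_partial_derivs :: "(real \<Rightarrow> real \<Rightarrow> real) \<Rightarrow> bool" where
  "has_partial_derivs V \<longleftrightarrow> (\<forall>x>0. \<forall>y>0.
     (\<lambda>x'. V x' y) differentiable (at x) \<and>
     (\<lambda>y'. V x y') differentiable (at y) \<and>
     (\<lambda>x'. deriv (\<lambda>y'. V x' y') y) differentiable (at x))"

text \<open>A density with respect to Lebesgue measure; in particular H has no mass on {0} and {1}.\<close>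

definition spectral_density :: "real measure \<Rightarrow> (real \<Rightarrow> real) \<Rightarrow> bool" where
  "spectral_density H h \<longleftrightarrow>
     h \<in> borel_measurable borel \<and> (\<forall>w. 0 \<le> h w) \<and> H = density lborel (\<lambda>w. ennreal (h w))"

text \<open>
  The constants have to be nonzero for the asymptotic equivalences to carry information:
  asymp_equiv to the zero function means being eventually zero.
\<close>

definition spectral_tails ::
    "(real \<Rightarrow> real) \<Rightarrow> real \<Rightarrow> real \<Rightarrow> real \<Rightarrow> real \<Rightarrow> bool" where
  "spectral_tails h c1 s1 c2 s2 \<longleftrightarrow>
     c1 \<noteq> 0 \<and> c2 \<noteq> 0 \<and> s1 > -1 \<and> s2 > -1 \<and>
     h \<sim>[at_left 1] (\<lambda>w. c1 * (1 - w) powr s1) \<and>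
     h \<sim>[at_right 0] (\<lambda>w. c2 * w powr s2)"

text \<open>
  The tail conditions say nothing about the density away from 0 and 1. If, for instance, the
  density of C12 vanishes near w = 1/2, or that of C13|2 vanishes on a suitable inner interval,
  then the gauge function differs from the stated one on rays with x1 = x2, or on rays where the
  two arguments of the max in case (i) agree. The following condition excludes this; it holds for
  every density that is continuous and positive on (0,1).
\<close>

definition locally_bounded_positive :: "(real \<Rightarrow> real) \<Rightarrow> bool" where
  "locally_bounded_positive h \<longleftrightarrow> (\<forall>a b. 0 < a \<and> a \<le> b \<and> b < 1 \<longrightarrow>
     (\<exists>m M. 0 < m \<and> (\<forall>w\<in>{a..b}. m \<le> h w \<and> h w \<le> M)))"


section \<open>Copulas and the trivariate vine\<close>

definition ev_copula :: "(real \<Rightarrow> real \<Rightarrow> real) \<Rightarrow> real \<Rightarrow> real \<Rightarrow> real" where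
  "ev_copula V u v = exp (- V (-1 / ln u) (-1 / ln v))"

definition inverted_ev_copula :: "(real \<Rightarrow> real \<Rightarrow> real) \<Rightarrow> real \<Rightarrow> real \<Rightarrow> real" where
  "inverted_ev_copula V u v = u + v - 1 + exp (- V (-1 / ln (1 - u)) (-1 / ln (1 - v)))"

definition copula_density :: "(real \<Rightarrow> real \<Rightarrow> real) \<Rightarrow> real \<Rightarrow> real \<Rightarrow> real" where
  "copula_density C u v = deriv (\<lambda>u'. deriv (\<lambda>v'. C u' v') v) u"

definition exp_cdf :: "real \<Rightarrow> real" where
  "exp_cdf x = 1 - exp (- x)"

text \<open>
  The arguments are C12, C23 and C13|2; F12 and F32 are the conditional distribution functions
  of the first and the third variable given the second.
\<close>

definition vine_density ::
    "(real \<Rightarrow> real \<Rightarrow> real) \<Rightarrow> (real \<Rightarrow> real \<Rightarrow> real) \<Rightarrow> (real \<Rightarrow> real \<Rightarrow> real) \<Rightarrow>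
     real \<times> real \<times> real \<Rightarrow> real" where
  "vine_density C12 C23 C132 = (\<lambda>(x1, x2, x3).
     if x1 > 0 \<and> x2 > 0 \<and> x3 > 0 then
       let F12 = deriv (\<lambda>v. C12 (exp_cdf x1) v) (exp_cdf x2);
           F32 = deriv (\<lambda>u. C23 u (exp_cdf x3)) (exp_cdf x2)
       in exp (- x1) * exp (- x2) * exp (- x3)
          * copula_density C12 (exp_cdf x1) (exp_cdf x2)
          * copula_density C23 (exp_cdf x2) (exp_cdf x3)
          * copula_density C132 F12 F32
     else 0)"


section \<open>Gauge functions and coefficients of tail dependence\<close>

definition nonneg_orthant :: "(real \<times> real \<times> real) set" where
  "nonneg_orthant = {(x1, x2, x3). x1 \<ge> 0 \<and> x2 \<ge> 0 \<and> x3 \<ge> 0}"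

definition pos_orthant :: "(real \<times> real \<times> real) set" where
  "pos_orthant = {(x1, x2, x3). x1 > 0 \<and> x2 > 0 \<and> x3 > 0}"

text \<open>
  The defining limit is imposed along rays in the open orthant, the support of a density with
  exponential margins. On the boundary of the orthant, where the value of a density is
  immaterial (extreme value copula densities of the kind considered here tend to 0 when exactly
  one argument tends to 0), the gauge function is determined by continuity.
\<close>

definition is_gauge_function ::
    "(real \<times> real \<times> real \<Rightarrow> real) \<Rightarrow> (real \<times> real \<times> real \<Rightarrow> real) \<Rightarrow> bool" where
  "is_gauge_function f g \<longleftrightarrow>
     (\<forall>x\<in>nonneg_orthant. \<forall>r>0. g (r *\<^sub>R x) = r * g x) \<and>
     continuous_on nonneg_orthant g \<and>
     (\<forall>x\<in>pos_orthant. (\<lambda>t. - ln (f (t *\<^sub>R x))) \<sim>[at_top] (\<lambda>t. t * g x))"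

definition slowly_varying :: "(real \<Rightarrow> real) \<Rightarrow> bool" where
  "slowly_varying L \<longleftrightarrow>
     L \<in> borel_measurable borel \<and> eventually (\<lambda>t. L t > 0) at_top \<and>
     (\<forall>r>0. ((\<lambda>t. L (r * t) / L t) \<longlongrightarrow> 1) at_top)"

definition is_tail_dependence_coeff ::
    "'a measure \<Rightarrow> (nat \<Rightarrow> 'a \<Rightarrow> real) \<Rightarrow> nat set \<Rightarrow> real \<Rightarrow> bool" where
  "is_tail_dependence_coeff M X C \<eta> \<longleftrightarrow>
     0 < \<eta> \<and> \<eta> \<le> 1 \<and>
     (\<exists>L. slowly_varying L \<and>
       (\<lambda>x. measure M {\<omega> \<in> space M. \<forall>i\<in>C. X i \<omega> > x})
         \<sim>[at_top] (\<lambda>x. L (exp x) * exp (- x / \<eta>)))"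

end

theory Submission
  imports Defs
begin

text \<open>
In the coordinates \<open>a = - ln u\<close>, \<open>b = - ln v\<close> (respectively \<open>- ln (1 - u)\<close>, \<open>- ln (1 - v)\<close> for
the inverted copula) the exponent measure becomes the stable tail dependence function
\<open>L a b = V (1 / a) (1 / b)\<close>, which is convex and homogeneous of degree one, and both kinds of
copula have the same density \<open>exp (a + b - L) * (La * Lb + D)\<close>, where \<open>La\<close> and \<open>Lb\<close> are the
partial derivatives of \<open>L\<close> and \<open>- D\<close> is the mixed one. The functions \<open>La\<close> and \<open>Lb\<close> depend only
on \<open>r = b / (a + b)\<close>: they are integrals of the spectral density over the two sides of \<open>r\<close>.
The tail conditions and the local bounds therefore turn into power bounds that hold uniformly on
the whole quadrant: \<open>Lb\<close> is comparable to \<open>r powr (1 + s2)\<close>, \<open>1 - Lb\<close> to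
\<open>(1 - r) powr (2 + s1)\<close>, and so on (locale \<open>stdf\<close>, obtained from a spectral density in
\<open>stdf_exists\<close>).

Uniformity is what makes the gauge function easy. Say that a positive function has rate \<open>\<rho>\<close> if
its logarithm divided by \<open>t\<close> tends to \<open>\<rho>\<close>. Rates behave well under products, powers and sums, so
the rate of each factor of the vine density along a ray can be read off from the rates of its
arguments (\<open>dens_rate\<close>, \<open>cond_level_rate\<close>), without distinguishing where on the ray the
coordinates lie. The result is one continuous formula \<open>gauge\<close>, built from minima and
from \<open>L\<close> for the conditional copula, and the four cases of the theorem are this formula with the
minima resolved (\<open>gauge_cases\<close>).

For the coefficients of tail dependence the logarithmic scale is too coarse. But the vine density
is \<open>exp (- y)\<close> times the mixed derivative in \<open>x\<close> and \<open>z\<close> of the conditional joint survival function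
\<open>S = exp (- L A B)\<close>, where \<open>A\<close> and \<open>B\<close> are the conditional levels
\<open>- ln (1 - F12)\<close> and \<open>- ln (1 - F32)\<close>. Hence the first and the third variable can be integrated
out exactly (\<open>slice_integral_eq\<close>). After the shift \<open>y = x + s\<close> and
multiplication by \<open>exp x\<close> the remaining integrand converges pointwise, because the arguments of the
homogeneous function \<open>Lb\<close> have a limiting ratio \<open>exp s\<close>, and it is dominated by
a two-sided exponential, because \<open>S \<le> 1 - F12\<close>. So \<open>exp x\<close> times the tail probability tends to a
positive constant, which serves as slowly varying function for \<open>\<eta> = 1\<close>
(\<open>tail_probability_asymptotics\<close>).
\<close>

section \<open>Power bounds for integrals of the spectral density\<close>

text \<open>
All bounds in the proof are two-sided bounds by powers, up to a constant factor that is uniform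
in the arguments.
\<close>
definition comparable :: "real \<Rightarrow> real \<Rightarrow> real \<Rightarrow> bool" where
  "comparable K x y \<longleftrightarrow> y / K \<le> x \<and> x \<le> K * y"

lemma comparable_mono:
  assumes "comparable K x y" "0 < K" "K \<le> K'" "0 \<le> y"
  shows "comparable K' x y"
proof -
  have "y / K' \<le> y / K" using assms by (intro divide_left_mono) auto
  moreover have "K * y \<le> K' * y" using assms by (intro mult_right_mono) auto
  ultimately show ?thesis using assms unfolding comparable_def by linarith
qed

lemma comparable_pos:
  assumes "comparable K x y" "0 < K" "0 < y"
  shows "0 < x"
proof -
  have "0 < y / K" using assms by simp
  then show ?thesis using assms unfolding comparable_def by linarith
qed

lemma comparable_mult:
  assumes "comparable K x y" "comparable K' x' y'" "0 < K" "0 < K'" "0 \<le> y" "0 \<le> y'"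
  shows "comparable (K * K') (x * x') (y * y')"
proof -
  have nn: "0 \<le> y / K" "0 \<le> y' / K'" using assms by auto
  have "y / K * (y' / K') \<le> x * x'"
    using assms nn unfolding comparable_def by (intro mult_mono) linarith+
  moreover have "0 \<le> x'" using nn assms(2) unfolding comparable_def by linarith
  then have "x * x' \<le> (K * y) * (K' * y')"
    using assms unfolding comparable_def by (intro mult_mono) simp_all
  ultimately show ?thesis unfolding comparable_def by (simp add: mult_ac)
qed

lemma comparable_add:
  assumes "comparable K x y" "comparable K x' y'"
  shows "comparable K (x + x') (y + y')"
  using assms unfolding comparable_def by (simp add: add_divide_distrib distrib_left)

lemma comparable_cmult:
  assumes "comparable K x y" "0 \<le> c"
  shows "comparable K (c * x) (c * y)"
proof -
  have "c * (y / K) \<le> c * x" "c * x \<le> c * (K * y)"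
    using assms unfolding comparable_def by (blast intro: mult_left_mono)+
  then show ?thesis unfolding comparable_def by (simp add: mult_ac)
qed

lemma comparable_endpoint_bound:
  fixes q :: "real \<Rightarrow> real"
  assumes "(q \<longlongrightarrow> c) F" "c > 0"
  shows "\<forall>\<^sub>F w in F. c / 2 \<le> q w \<and> q w \<le> 2 * c"
proof -
  have "\<forall>\<^sub>F w in F. c / 2 < q w" "\<forall>\<^sub>F w in F. q w < 2 * c"
    using assms(2) by (intro order_tendstoD[OF assms(1)]; simp)+
  then show ?thesis by eventually_elim auto
qed

text \<open>
A nonnegative function cannot be asymptotic to a negative multiple of a positive one, so the tail
constants are positive. The factor \<open>v\<close> stands for the power belonging to the opposite endpoint,
which tends to 1.
\<close>
lemma asymp_equiv_quotient:
  fixes h u v :: "real \<Rightarrow> real"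
  assumes "h \<sim>[F] (\<lambda>w. c * u w)" "\<And>w. 0 \<le> h w" "c \<noteq> 0" "F \<noteq> bot"
    "\<forall>\<^sub>F w in F. 0 < u w" "(v \<longlongrightarrow> 1) F" "\<forall>\<^sub>F w in F. 0 < v w"
  shows "((\<lambda>w. h w / (u w * v w)) \<longlongrightarrow> c) F" "c > 0"
proof -
  have 1: "((\<lambda>w. if h w = 0 \<and> c * u w = 0 then 1 else h w / (c * u w)) \<longlongrightarrow> 1) F"
    using assms(1) unfolding asymp_equiv_def .
  have "((\<lambda>w. c * (if h w = 0 \<and> c * u w = 0 then 1 else h w / (c * u w)) / v w) \<longlongrightarrow> c * 1 / 1) F"
    by (intro tendsto_intros 1 assms) simp
  then show *: "((\<lambda>w. h w / (u w * v w)) \<longlongrightarrow> c) F"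
    apply (simp only: mult_1_right div_by_1)
    apply (erule Lim_transform_eventually)
    using assms(5,7) by eventually_elim (use assms(3) in \<open>auto simp: field_simps\<close>)
  have "\<forall>\<^sub>F w in F. 0 \<le> h w / (u w * v w)"
    using assms(5,7) by eventually_elim (use assms(2) in auto)
  then have "0 \<le> c" using tendsto_lowerbound[OF * _ assms(4)] by auto
  then show "c > 0" using assms(3) by simp
qed

text \<open>
The tail conditions control the quotient of \<open>h\<close> and the product of powers near the two endpoints;
on the compact interval that is left, local boundedness controls \<open>h\<close>, and the product of
powers is continuous and positive there.
\<close>
lemma density_comparable:
  assumes tails: "spectral_tails h c1 s1 c2 s2" and nn: "\<And>w. 0 \<le> h w"
    and lb: "locally_bounded_positive h"
  shows "\<exists>K\<ge>1. \<forall>w. 0 < w \<longrightarrow> w < 1 \<longrightarrow> comparable K (h w) (w powr s2 * (1 - w) powr s1)"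
proof -
  define q where "q = (\<lambda>w. h w / (w powr s2 * (1 - w) powr s1))"
  have t: "c1 \<noteq> 0" "c2 \<noteq> 0" "h \<sim>[at_left 1] (\<lambda>w. c1 * (1 - w) powr s1)"
    "h \<sim>[at_right 0] (\<lambda>w. c2 * w powr s2)"
    using tails unfolding spectral_tails_def by auto
  have le1: "\<forall>\<^sub>F w in at_left (1::real). 0 < w \<and> w < 1"
    by (rule eventually_at_leftI[of 0]) auto
  have ge0: "\<forall>\<^sub>F w in at_right (0::real). 0 < w \<and> w < 1"
    by (rule eventually_at_rightI[of _ 1]) auto
  have q1: "((\<lambda>w. h w / ((1 - w) powr s1 * w powr s2)) \<longlongrightarrow> c1) (at_left 1)" "c1 > 0"
    by (rule asymp_equiv_quotient[OF t(3) nn t(1)],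
        (auto intro!: tendsto_eq_intros eventually_mono[OF le1])[4])+
  have q2: "((\<lambda>w. h w / (w powr s2 * (1 - w) powr s1)) \<longlongrightarrow> c2) (at_right 0)" "c2 > 0"
    by (rule asymp_equiv_quotient[OF t(4) nn t(2)],
        (auto intro!: tendsto_eq_intros eventually_mono[OF ge0])[4])+
  have "\<forall>\<^sub>F w in at_left 1. c1 / 2 \<le> q w \<and> q w \<le> 2 * c1"
    using comparable_endpoint_bound[OF q1] by (simp add: q_def mult.commute)
  then obtain b where b: "b < 1" "\<And>w. b < w \<Longrightarrow> w < 1 \<Longrightarrow> c1 / 2 \<le> q w \<and> q w \<le> 2 * c1"
    unfolding eventually_at_left_field by auto
  have "\<forall>\<^sub>F w in at_right 0. c2 / 2 \<le> q w \<and> q w \<le> 2 * c2"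
    using comparable_endpoint_bound[OF q2] by (simp add: q_def)
  then obtain a where a: "0 < a" "\<And>w. 0 < w \<Longrightarrow> w < a \<Longrightarrow> c2 / 2 \<le> q w \<and> q w \<le> 2 * c2"
    unfolding eventually_at_right_field by auto
  define a' where "a' = min (1/2) a"
  define b' where "b' = max (1/2) b"
  have ab: "0 < a'" "a' \<le> b'" "b' < 1" using a b by (auto simp: a'_def b'_def)
  obtain m M where m: "0 < m" "\<And>w. w \<in> {a'..b'} \<Longrightarrow> m \<le> h w \<and> h w \<le> M"
    using lb ab unfolding locally_bounded_positive_def by blast
  define \<psi> where "\<psi> = (\<lambda>w. w powr s2 * (1 - w) powr s1)"
  have cont: "continuous_on {a'..b'} \<psi>"
    unfolding \<psi>_def using ab by (intro continuous_intros) auto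
  have ne: "{a'..b'} \<noteq> {}" using ab by auto
  obtain w1 where w1: "w1 \<in> {a'..b'}" "\<And>w. w \<in> {a'..b'} \<Longrightarrow> \<psi> w1 \<le> \<psi> w"
    using continuous_attains_inf[OF compact_Icc ne cont] by blast
  obtain w2 where w2: "w2 \<in> {a'..b'}" "\<And>w. w \<in> {a'..b'} \<Longrightarrow> \<psi> w \<le> \<psi> w2"
    using continuous_attains_sup[OF compact_Icc ne cont] by blast
  have pos: "0 < \<psi> w" if "0 < w" "w < 1" for w using that by (simp add: \<psi>_def)
  have p1: "0 < \<psi> w1" "0 < \<psi> w2" using w1(1) w2(1) ab by (auto intro!: pos)
  define K where "K = Max {1, 2 * c1, 2 / c1, 2 * c2, 2 / c2, M / \<psi> w1, \<psi> w2 / m}"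
  have K: "1 \<le> K" "2 * c1 \<le> K" "2 / c1 \<le> K" "2 * c2 \<le> K" "2 / c2 \<le> K" "M / \<psi> w1 \<le> K" "\<psi> w2 / m \<le> K"
    unfolding K_def by (rule Max_ge; simp)+
  have "comparable K (h w) (w powr s2 * (1 - w) powr s1)" if w: "0 < w" "w < 1" for w
  proof -
    have edge: "comparable K (h w) (\<psi> w)"
      if c: "c > 0" "c / 2 \<le> q w" "q w \<le> 2 * c" "2 * c \<le> K" "2 / c \<le> K" for c
    proof -
      have hq: "h w = q w * \<psi> w" using w unfolding q_def \<psi>_def by simp
      have "1 / K \<le> c / 2" using c K by (simp add: field_simps)
      then have "1 / K * \<psi> w \<le> q w * \<psi> w" using c pos[OF w] by (intro mult_right_mono) auto
      moreover have "q w * \<psi> w \<le> K * \<psi> w" using c pos[OF w] by (intro mult_right_mono) auto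
      ultimately show ?thesis unfolding comparable_def hq by simp
    qed
    consider "w < a" | "b < w" | "w \<in> {a'..b'}" using a'_def b'_def w by fastforce
    then have "comparable K (h w) (\<psi> w)"
    proof cases
      case 1 then show ?thesis using edge[OF q2(2)] a(2)[OF w(1)] K by auto
    next
      case 2 then show ?thesis using edge[OF q1(2)] b(2)[OF _ w(2)] K by auto
    next
      case 3
      have "\<psi> w \<le> \<psi> w2" "\<psi> w1 \<le> \<psi> w" using w1 w2 3 by auto
      moreover have "\<psi> w2 \<le> K * m" using K(7) m by (simp add: field_simps)
      moreover have "M \<le> K * \<psi> w1" using K(6) p1 by (simp add: field_simps)
      moreover have "K * \<psi> w1 \<le> K * \<psi> w" using K \<open>\<psi> w1 \<le> \<psi> w\<close> by (intro mult_left_mono) auto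
      moreover have "K * m \<le> K * h w" using K m(2)[OF 3] by (intro mult_left_mono) auto
      ultimately have "\<psi> w \<le> K * h w" "h w \<le> K * \<psi> w" using m(2)[OF 3] by linarith+
      then show ?thesis unfolding comparable_def using K by (simp add: field_simps)
    qed
    then show ?thesis unfolding \<psi>_def .
  qed
  then show ?thesis using K by blast
qed

lemma powr_one_minus_bounds:
  fixes w q :: real
  assumes "0 \<le> w" "w \<le> 1/2"
  shows "2 powr - \<bar>q\<bar> \<le> (1 - w) powr q" "(1 - w) powr q \<le> 2 powr \<bar>q\<bar>"
proof -
  have l: "- ln 2 \<le> ln (1 - w)" using assms ln_mono[of "1/2" "1 - w"] by (simp add: ln_div)
  have u: "ln (1 - w) \<le> 0" using assms by simp
  have "\<bar>q * ln (1 - w)\<bar> \<le> \<bar>q\<bar> * ln 2" unfolding abs_mult using l u by (intro mult_left_mono) auto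
  then have "- \<bar>q\<bar> * ln 2 \<le> q * ln (1 - w)" "q * ln (1 - w) \<le> \<bar>q\<bar> * ln 2" by auto
  then show "2 powr - \<bar>q\<bar> \<le> (1 - w) powr q" "(1 - w) powr q \<le> 2 powr \<bar>q\<bar>"
    using assms unfolding powr_def by auto
qed

text \<open>
Up to \<open>r = 1/2\<close> the factor belonging to the other endpoint lies between constants and the power of \<open>w\<close>
can be integrated. Beyond \<open>1/2\<close> the integral lies between its values at \<open>1/2\<close> and \<open>1\<close>, and so does
the power of \<open>r\<close> up to constants.
\<close>
lemma integral_power_comparable:
  fixes \<phi> :: "real \<Rightarrow> real"
  assumes int: "\<phi> integrable_on {0..1}" and nn: "\<And>w. w \<in> {0..1} \<Longrightarrow> 0 \<le> \<phi> w"
    and K: "K \<ge> 1" and p: "p > -1"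
    and cmp: "\<And>w. 0 < w \<Longrightarrow> w < 1 \<Longrightarrow> comparable K (\<phi> w) (w powr p * (1 - w) powr q)"
  shows "\<exists>K'\<ge>1. \<forall>r. 0 < r \<longrightarrow> r < 1 \<longrightarrow> comparable K' (integral {0..r} \<phi>) (r powr (1 + p))"
proof -
  define I where "I = (\<lambda>r. integral {0..r} \<phi>)"
  have sub: "\<phi> integrable_on {0..r}" if "r \<le> 1" for r
    using integrable_on_subinterval[OF int, of 0 r] that by auto
  define K1 where "K1 = K * 2 powr \<bar>q\<bar>"
  have "1 * 1 \<le> K * 2 powr \<bar>q\<bar>" using K by (intro mult_mono ge_one_powr_ge_zero) auto
  then have K1: "K1 \<ge> 1" by (simp add: K1_def)
  have cmp1: "comparable K1 (\<phi> w) (w powr p)" if "0 < w" "w \<le> 1/2" for w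
  proof -
    have b: "1 / 2 powr \<bar>q\<bar> \<le> (1 - w) powr q" "(1 - w) powr q \<le> 2 powr \<bar>q\<bar>"
      using powr_one_minus_bounds[of w q] that by (simp_all only: powr_minus_divide)
    have c: "w powr p * (1 - w) powr q / K \<le> \<phi> w" "\<phi> w \<le> K * (w powr p * (1 - w) powr q)"
      using cmp[of w] that unfolding comparable_def by auto
    have "w powr p * (1 / 2 powr \<bar>q\<bar>) / K \<le> w powr p * (1 - w) powr q / K"
      using b K by (intro divide_right_mono mult_left_mono) auto
    moreover have "K * (w powr p * (1 - w) powr q) \<le> K * (w powr p * 2 powr \<bar>q\<bar>)"
      using b K by (intro mult_left_mono) auto
    ultimately show ?thesis using c unfolding comparable_def K1_def by (simp add: mult_ac)
  qed
  define K2 where "K2 = max (K1 / (1 + p)) (K1 * (1 + p))"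
  have half: "comparable K2 (I r) (r powr (1 + p))" if r: "0 < r" "r \<le> 1/2" for r
  proof -
    have P: "((\<lambda>w. w powr p) has_integral (r powr (1 + p) / (1 + p))) {0..r}"
      using has_integral_powr_from_0[OF p, of r] r by (simp add: add.commute)
    have H: "((\<lambda>w. if w = 0 then 0 else \<phi> w) has_integral I r) {0..r}"
      by (rule has_integral_spike_finite[where S="{0}" and f=\<phi>])
         (use sub[of r] r in \<open>auto simp: I_def\<close>)
    have "r powr (1 + p) / (1 + p) / K1 \<le> I r"
      by (rule has_integral_le[OF has_integral_divide[OF P] H])
         (use cmp1 r in \<open>auto simp: comparable_def\<close>)
    moreover have "I r \<le> K1 * (r powr (1 + p) / (1 + p))"
      by (rule has_integral_le[OF H has_integral_mult_right[OF P]])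
         (use cmp1 r in \<open>auto simp: comparable_def\<close>)
    ultimately have "comparable K1 (I r) (r powr (1 + p) / (1 + p))"
      unfolding comparable_def by simp
    moreover have "K1 / (1 + p) * r powr (1 + p) \<le> K2 * r powr (1 + p)"
      unfolding K2_def by (intro mult_right_mono) auto
    moreover have "r powr (1 + p) / K2 \<le> r powr (1 + p) / (K1 * (1 + p))"
      using K1 p unfolding K2_def by (intro divide_left_mono) (auto intro!: mult_pos_pos simp: less_max_iff_disj)
    ultimately show ?thesis unfolding comparable_def by (simp add: mult_ac)
  qed
  have K2: "K2 > 0" using K1 p by (simp add: K2_def less_max_iff_disj)
  have Imono: "I r \<le> I r'" if "0 \<le> r" "r \<le> r'" "r' \<le> 1" for r r'
    unfolding I_def using that sub nn by (intro integral_subset_le) auto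
  have Ih: "0 < I (1/2)" using comparable_pos[OF half K2] by auto
  define K3 where "K3 = Max {1, K2, 1 / I (1/2), I 1 * 2 powr (1 + p)}"
  have K3: "1 \<le> K3" "K2 \<le> K3" "1 / I (1/2) \<le> K3" "I 1 * 2 powr (1 + p) \<le> K3"
    unfolding K3_def by (rule Max_ge; simp)+
  have "comparable K3 (I r) (r powr (1 + p))" if r: "0 < r" "r < 1" for r
  proof (cases "r \<le> 1/2")
    case True
    then show ?thesis using comparable_mono[OF half K2 K3(2)] r by auto
  next
    case False
    have a: "r powr (1 + p) \<le> 1" using r p powr_mono2[of "1 + p" r 1] by simp
    have b: "(1/2) powr (1 + p) \<le> r powr (1 + p)" using False p by (intro powr_mono2) auto
    have "r powr (1 + p) / K3 \<le> 1 / K3" using a K3 by (intro divide_right_mono) auto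
    also have "1 / K3 \<le> I (1/2)" using K3 Ih by (simp add: field_simps)
    also have "\<dots> \<le> I r" using False r by (intro Imono) auto
    finally have 1: "r powr (1 + p) / K3 \<le> I r" .
    have "I r \<le> I 1" using r by (intro Imono) auto
    also have "\<dots> = (I 1 * 2 powr (1 + p)) * (1/2) powr (1 + p)"
      by (simp add: powr_divide)
    also have "\<dots> \<le> K3 * r powr (1 + p)" using K3 b by (intro mult_mono) auto
    finally show ?thesis using 1 unfolding comparable_def by simp
  qed
  then show ?thesis using K3 unfolding I_def by blast
qed

lemma integral_reflect_unit:
  fixes \<phi> :: "real \<Rightarrow> real"
  assumes "\<phi> integrable_on {a..b}"
  shows "((\<lambda>w. \<phi> (1 - w)) has_integral integral {a..b} \<phi>) {1 - b..1 - a}"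
proof (cases "a \<le> b")
  case True
  have "(\<phi> has_integral integral {a..b} \<phi>) (cbox a b)" using assms by auto
  from has_integral_affinity[OF this, of "-1" 1]
  have "((\<lambda>w. \<phi> (1 - w)) has_integral integral {a..b} \<phi>) ((\<lambda>x. 1 - x) ` {a..b})"
    by simp
  moreover have "(\<lambda>x. 1 - x) ` {a..b} = {1 - b..1 - a}" by auto
  ultimately show ?thesis by simp
qed auto

lemma integral_power_comparable':
  fixes \<phi> :: "real \<Rightarrow> real"
  assumes int: "\<phi> integrable_on {0..1}" and nn: "\<And>w. w \<in> {0..1} \<Longrightarrow> 0 \<le> \<phi> w"
    and K: "K \<ge> 1" and q: "q > -1"
    and cmp: "\<And>w. 0 < w \<Longrightarrow> w < 1 \<Longrightarrow> comparable K (\<phi> w) (w powr p * (1 - w) powr q)"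
  shows "\<exists>K'\<ge>1. \<forall>r. 0 < r \<longrightarrow> r < 1 \<longrightarrow> comparable K' (integral {r..1} \<phi>) ((1 - r) powr (1 + q))"
proof -
  have "\<exists>K'\<ge>1. \<forall>r. 0 < r \<longrightarrow> r < 1 \<longrightarrow>
      comparable K' (integral {0..r} (\<lambda>w. \<phi> (1 - w))) (r powr (1 + q))"
  proof (rule integral_power_comparable[OF _ _ K q])
    show "(\<lambda>w. \<phi> (1 - w)) integrable_on {0..1}" using integral_reflect_unit[OF int] by auto
    show "comparable K (\<phi> (1 - w)) (w powr q * (1 - w) powr p)" if "0 < w" "w < 1" for w
      using cmp[of "1 - w"] that by (simp add: mult.commute)
  qed (use nn in auto)
  then obtain K' where K': "K' \<ge> 1" "\<And>r. 0 < r \<Longrightarrow> r < 1 \<Longrightarrow>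
      comparable K' (integral {0..r} (\<lambda>w. \<phi> (1 - w))) (r powr (1 + q))" by blast
  have "comparable K' (integral {r..1} \<phi>) ((1 - r) powr (1 + q))" if "0 < r" "r < 1" for r
  proof -
    have "\<phi> integrable_on {r..1}" using integrable_on_subinterval[OF int, of r 1] that by auto
    from integral_unique[OF integral_reflect_unit[OF this]] K'(2)[of "1 - r"] that
    show ?thesis by simp
  qed
  then show ?thesis using K' by blast
qed

text \<open>
The spectral density is determined only up to null sets, whereas the copula density contains the derivative
of an indefinite integral at every single point. Pointwise bounds pass from the integrand to
this derivative: if \<open>P\<close> is a primitive of the continuous bound \<open>g\<close>, then \<open>K * P - G\<close> and
\<open>G - P / K\<close> are increasing.
\<close>
lemma derivative_comparable:
  fixes G \<phi> g :: "real \<Rightarrow> real"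
  assumes r: "0 < r" "r < 1" and G: "(G has_real_derivative d) (at r)"
    and inc: "\<And>x y. 0 < x \<Longrightarrow> x \<le> y \<Longrightarrow> y < 1 \<Longrightarrow> (\<phi> has_integral G y - G x) {x..y}"
    and cmp: "\<And>w. 0 < w \<Longrightarrow> w < 1 \<Longrightarrow> comparable K (\<phi> w) (g w)"
    and g: "continuous_on {0<..<1} g"
  shows "comparable K d (g r)"
proof -
  define c e where "c = r / 2" and "e = (1 + r) / 2"
  have ce: "0 < c" "c < r" "r < e" "e < 1" using r by (auto simp: c_def e_def)
  define P where "P = (\<lambda>y. integral {c..y} g)"
  have gc: "continuous_on {c..e} g" using ce by (intro continuous_on_subset[OF g]) auto
  have "(P has_real_derivative g r) (at r within {c..e})"
    unfolding P_def using gc ce by (intro integral_has_real_derivative) auto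
  then have P: "(P has_real_derivative g r) (at r)"
    using ce at_within_Icc_at[of c r e] by simp
  have Pint: "(g has_integral P y - P x) {x..y}" if "c < x" "x \<le> y" "y < e" for x y
  proof -
    have "g integrable_on {c..y}" "g integrable_on {x..y}"
      using that by (auto intro!: integrable_continuous_real continuous_on_subset[OF gc])
    then have "(g has_integral integral {x..y} g) {x..y}" "P y = P x + integral {x..y} g"
      unfolding P_def using Henstock_Kurzweil_Integration.integral_combine[of c x y g] that by auto
    then show ?thesis by simp
  qed
  have key: "0 \<le> D" if F: "(F has_real_derivative D) (at r)"
    and m: "\<And>x y. c < x \<Longrightarrow> x \<le> y \<Longrightarrow> y < e \<Longrightarrow> F x \<le> F y" for F D
  proof -
    have "((\<lambda>y. (F y - F r) / (y - r)) \<longlongrightarrow> D) (at r)"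
      using F by (simp add: has_field_derivative_iff)
    moreover have "\<forall>\<^sub>F y in at r. 0 \<le> (F y - F r) / (y - r)"
    proof -
      have "\<forall>\<^sub>F y in at r. y \<in> {c<..<e}"
        using eventually_at_in_open'[of "{c<..<e}" r] ce by auto
      then show ?thesis
      proof eventually_elim
        case (elim y)
        then show ?case using m[of r y] m[of y r] ce
          by (cases "y \<le> r") (auto simp: divide_nonneg_nonneg divide_nonpos_nonpos)
      qed
    qed
    ultimately show ?thesis by (intro tendsto_lowerbound) auto
  qed
  have "0 \<le> K * g r - d"
  proof (rule key[of "\<lambda>y. K * P y - G y"])
    show "((\<lambda>y. K * P y - G y) has_real_derivative K * g r - d) (at r)"
      by (auto intro!: derivative_eq_intros P G)
    fix x y assume xy: "c < x" "x \<le> y" "y < e"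
    have "G y - G x \<le> K * (P y - P x)"
      using ce xy cmp
      by (intro has_integral_le[OF inc[of x y] has_integral_mult_right[OF Pint[of x y], of K]])
         (auto simp: comparable_def)
    then show "K * P x - G x \<le> K * P y - G y" by (simp add: algebra_simps)
  qed
  moreover have "0 \<le> d - g r / K"
  proof (rule key[of "\<lambda>y. G y - P y / K"])
    show "((\<lambda>y. G y - P y / K) has_real_derivative d - g r / K) (at r)"
      by (intro DERIV_diff DERIV_cdivide P G)
    fix x y assume xy: "c < x" "x \<le> y" "y < e"
    have "(P y - P x) / K \<le> G y - G x"
      using ce xy cmp
      by (intro has_integral_le[OF has_integral_divide[OF Pint[of x y], of K] inc[of x y]])
         (auto simp: comparable_def)
    then show "G x - P x / K \<le> G y - P y / K" by (simp add: diff_divide_distrib)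
  qed
  ultimately show ?thesis unfolding comparable_def by simp
qed

section \<open>The stable tail dependence function\<close>

text \<open>
The stable tail dependence function with its partial derivatives and with the power bounds that it
inherits from the spectral density; \<open>- D\<close> is the mixed second derivative. The axioms are
symmetric under exchanging the two arguments, so that facts about conditioning on the
second variable also serve for conditioning on the first one.
\<close>
locale stdf =
  fixes L La Lb D :: "real \<Rightarrow> real \<Rightarrow> real" and s1 s2 K :: real
  assumes s1: "s1 > -1" and s2: "s2 > -1" and K: "K \<ge> 1"
    and L_homogeneous: "0 \<le> c \<Longrightarrow> L (c * a) (c * b) = c * L a b"
    and L_ge: "a \<le> L a b" "b \<le> L a b"
    and L_lipschitz: "L a b \<le> L a' b' + \<bar>a - a'\<bar> + \<bar>b - b'\<bar>"
    and euler: "0 < a \<Longrightarrow> 0 < b \<Longrightarrow> L a b = a * La a b + b * Lb a b"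
    and La_homogeneous: "0 < c \<Longrightarrow> La (c * a) (c * b) = La a b"
    and Lb_homogeneous: "0 < c \<Longrightarrow> Lb (c * a) (c * b) = Lb a b"
    and L_deriv1: "0 < a \<Longrightarrow> 0 < b \<Longrightarrow> ((\<lambda>x. L x b) has_real_derivative La a b) (at a)"
    and L_deriv2: "0 < a \<Longrightarrow> 0 < b \<Longrightarrow> ((\<lambda>y. L a y) has_real_derivative Lb a b) (at b)"
    and La_deriv2: "0 < a \<Longrightarrow> 0 < b \<Longrightarrow> ((\<lambda>y. La a y) has_real_derivative - D a b) (at b)"
    and Lb_deriv1: "0 < a \<Longrightarrow> 0 < b \<Longrightarrow> ((\<lambda>x. Lb x b) has_real_derivative - D a b) (at a)"
    and La_bound: "0 < a \<Longrightarrow> 0 < b \<Longrightarrow> comparable K (La a b) ((a / (a + b)) powr (1 + s1))"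
    and Lb_bound: "0 < a \<Longrightarrow> 0 < b \<Longrightarrow> comparable K (Lb a b) ((b / (a + b)) powr (1 + s2))"
    and La_bound': "0 < a \<Longrightarrow> 0 < b \<Longrightarrow> comparable K (1 - La a b) ((b / (a + b)) powr (2 + s2))"
    and Lb_bound': "0 < a \<Longrightarrow> 0 < b \<Longrightarrow> comparable K (1 - Lb a b) ((a / (a + b)) powr (2 + s1))"
    and D_bound: "0 < a \<Longrightarrow> 0 < b \<Longrightarrow>
      comparable K ((a + b) * D a b) ((a / (a + b)) powr (1 + s1) * (b / (a + b)) powr (1 + s2))"

lemma stdf_flip:
  assumes "stdf L La Lb D s1 s2 K"
  shows "stdf (\<lambda>a b. L b a) (\<lambda>a b. Lb b a) (\<lambda>a b. La b a) (\<lambda>a b. D b a) s2 s1 K"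
proof -
  interpret stdf L La Lb D s1 s2 K by fact
  show ?thesis
  proof
    show "s2 > -1" "s1 > -1" "1 \<le> K" using s1 s2 K by auto
    show "0 \<le> c \<Longrightarrow> L (c * b) (c * a) = c * L b a" for a b c by (rule L_homogeneous)
    show "a \<le> L b a" "b \<le> L b a" for a b by (rule L_ge)+
    show "L b a \<le> L b' a' + \<bar>a - a'\<bar> + \<bar>b - b'\<bar>" for a b a' b'
      using L_lipschitz[of b a b' a'] by linarith
    fix a b :: real
    show "0 < c \<Longrightarrow> Lb (c * b) (c * a) = Lb b a" "0 < c \<Longrightarrow> La (c * b) (c * a) = La b a" for c
      by (simp_all add: La_homogeneous Lb_homogeneous)
    assume ab: "0 < a" "0 < b"
    have c: "a + b = b + a" by simp
    show "L b a = a * Lb b a + b * La b a" using euler[of b a] ab by simp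
    show "((\<lambda>x. L b x) has_real_derivative Lb b a) (at a)"
      "((\<lambda>y. L y a) has_real_derivative La b a) (at b)"
      "((\<lambda>y. Lb y a) has_real_derivative - D b a) (at b)"
      "((\<lambda>x. La b x) has_real_derivative - D b a) (at a)"
      by (rule L_deriv1 L_deriv2 La_deriv2 Lb_deriv1; fact ab)+
    show "comparable K (Lb b a) ((a / (a + b)) powr (1 + s2))"
      "comparable K (La b a) ((b / (a + b)) powr (1 + s1))"
      "comparable K (1 - Lb b a) ((b / (a + b)) powr (2 + s1))"
      "comparable K (1 - La b a) ((a / (a + b)) powr (2 + s2))"
      unfolding c by (rule La_bound Lb_bound La_bound' Lb_bound'; fact ab)+
    show "comparable K ((a + b) * D b a) ((a / (a + b)) powr (1 + s2) * (b / (a + b)) powr (1 + s1))"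
      using D_bound[OF ab(2,1)] unfolding c by (simp only: mult.commute)
  qed
qed

lemma max_weighted_bound:
  fixes a b w :: real
  assumes "w \<in> {0..1}"
  shows "\<bar>max (w * a) ((1 - w) * b)\<bar> \<le> \<bar>a\<bar> + \<bar>b\<bar>"
proof -
  have "\<bar>w * a\<bar> \<le> \<bar>a\<bar>" "\<bar>(1 - w) * b\<bar> \<le> \<bar>b\<bar>"
    using assms by (auto simp: abs_mult intro!: mult_left_le_one_le)
  then show ?thesis by linarith
qed

text \<open>
The slope of an affine minorant that touches a differentiable function is its derivative. This
gives the first derivatives of \<open>L\<close> without differentiating an integral with a
moving boundary.
\<close>
lemma derivative_eq_tangent:
  fixes f :: "real \<Rightarrow> real"
  assumes "(f has_real_derivative d) (at x)" "0 < x"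
    and "\<And>y. 0 < y \<Longrightarrow> c + y * m \<le> f y" "f x = c + x * m"
  shows "d = m"
proof -
  have "((\<lambda>y. f y - y * m) has_real_derivative d - m) (at x)"
    by (auto intro!: derivative_eq_intros assms)
  then have "d - m = 0"
  proof (rule DERIV_local_min[OF _ assms(2)], intro allI impI)
    fix y assume "\<bar>x - y\<bar> < x"
    then have "0 < y" by linarith
    then show "f x - x * m \<le> f y - y * m" using assms(3)[of y] assms(4) by linarith
  qed
  then show ?thesis by simp
qed

locale spectral_model =
  fixes H :: "real measure" and h :: "real \<Rightarrow> real" and c1 s1 c2 s2 :: real
  assumes distr: "spectral_distribution H" and dens: "spectral_density H h"
    and tails: "spectral_tails h c1 s1 c2 s2" and lbp: "locally_bounded_positive h"
    and partials: "has_partial_derivs (exponent_measure H)"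
begin

lemma h_nonneg: "0 \<le> h w" and h_measurable [measurable]: "h \<in> borel_measurable borel"
  and H_eq: "H = density lborel (\<lambda>w. ennreal (h w))"
  using dens unfolding spectral_density_def by auto

sublocale prob_space H using distr unfolding spectral_distribution_def by auto

lemma bounded_integral:
  assumes [measurable]: "\<phi> \<in> borel_measurable borel" and B: "\<And>w. w \<in> {0..1} \<Longrightarrow> \<bar>\<phi> w\<bar> \<le> B"
  shows "(\<lambda>w. \<phi> w * h w) integrable_on {0..1}"
    and "(LINT w:{0..1}|H. \<phi> w) = integral {0..1} (\<lambda>w. \<phi> w * h w)"
proof -
  have [measurable_cong]: "sets H = sets borel" by (simp add: H_eq)
  have B0: "0 \<le> B" using B[of 0] by auto
  have "integrable H (\<lambda>w. indicator {0..1} w *\<^sub>R \<phi> w)"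
    by (rule integrable_const_bound[where B=B]) (use B B0 in \<open>auto simp: indicator_def\<close>)
  then have "integrable (density lborel (\<lambda>w. ennreal (h w))) (\<lambda>w. indicator {0..1} w *\<^sub>R \<phi> w)"
    unfolding H_eq .
  then have "integrable lborel (\<lambda>w. h w *\<^sub>R (indicator {0..1} w *\<^sub>R \<phi> w))"
    by (subst (asm) integrable_density) (auto simp: h_nonneg)
  then have int: "set_integrable lborel {0..1} (\<lambda>w. \<phi> w * h w)"
    unfolding set_integrable_def by (simp add: mult_ac)
  show "(\<lambda>w. \<phi> w * h w) integrable_on {0..1}" using set_borel_integral_eq_integral(1)[OF int] .
  have "(LINT w:{0..1}|H. \<phi> w) = (LINT w:{0..1}|lborel. \<phi> w * h w)"
    unfolding set_lebesgue_integral_def H_eq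
    by (subst integral_density) (auto simp: h_nonneg mult_ac)
  then show "(LINT w:{0..1}|H. \<phi> w) = integral {0..1} (\<lambda>w. \<phi> w * h w)"
    using set_borel_integral_eq_integral(2)[OF int] by simp
qed

lemma total_and_mean:
  "integral {0..1} h = 1" "integral {0..1} (\<lambda>w. w * h w) = 1/2"
proof -
  have [measurable_cong]: "sets H = sets borel" by (simp add: H_eq)
  have "emeasure H (- {0..1}) = 0" using distr unfolding spectral_distribution_def by auto
  then have ae: "AE w in H. w \<in> {0..1}" by (intro AE_I[where N="- {0..1}"]) auto
  have *: "(LINT w:{0..1}|H. \<phi> w) = (\<integral>w. \<phi> w \<partial>H)" if [measurable]: "\<phi> \<in> borel_measurable borel" for \<phi>
    unfolding set_lebesgue_integral_def
    by (rule integral_cong_AE) (use ae in \<open>auto simp: indicator_def\<close>)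
  have "(\<integral>w. w \<partial>H) = 1/2" using distr unfolding spectral_distribution_def by auto
  then show "integral {0..1} (\<lambda>w. w * h w) = 1/2"
    using *[of "\<lambda>w. w"] bounded_integral(2)[of "\<lambda>w. w" 1] by simp
  have "integral {0..1} h = (LINT w:{0..1}|H. 1)" using bounded_integral(2)[of "\<lambda>w. 1" 1] by simp
  also have "\<dots> = (\<integral>w. 1 \<partial>H)" by (rule *) simp
  also have "\<dots> = 1" by (simp add: prob_space)
  finally show "integral {0..1} h = 1" .
qed

definition L :: "real \<Rightarrow> real \<Rightarrow> real" where
  "L a b = exponent_measure H (inverse a) (inverse b)"

text \<open>
At \<open>r = b / (a + b)\<close> the two terms of the maximum in \<open>L a b\<close> change their order. The functions \<open>G\<close> and
\<open>G1\<close> are the partial derivatives of \<open>L\<close> in \<open>b\<close> and in \<open>a\<close>, as functions of \<open>r\<close>.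
\<close>
definition G :: "real \<Rightarrow> real" where
  "G r = 2 * integral {0..r} (\<lambda>w. (1 - w) * h w)"

definition G1 :: "real \<Rightarrow> real" where
  "G1 r = 2 * integral {r..1} (\<lambda>w. w * h w)"

lemma integrable_mult:
  "(\<lambda>w. w * h w) integrable_on {0..1}" "(\<lambda>w. (1 - w) * h w) integrable_on {0..1}"
  "(\<lambda>w. max (w * a) ((1 - w) * b) * h w) integrable_on {0..1}"
proof -
  show "(\<lambda>w. w * h w) integrable_on {0..1}" by (rule bounded_integral[where B=1]) auto
  show "(\<lambda>w. (1 - w) * h w) integrable_on {0..1}" by (rule bounded_integral[where B=1]) auto
  show "(\<lambda>w. max (w * a) ((1 - w) * b) * h w) integrable_on {0..1}"
    by (rule bounded_integral[where B="\<bar>a\<bar> + \<bar>b\<bar>"]) (auto intro!: max_weighted_bound)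
qed

lemma L_eq: "L a b = 2 * integral {0..1} (\<lambda>w. max (w * a) ((1 - w) * b) * h w)"
proof -
  have "(LINT w:{0..1}|H. max (w * a) ((1 - w) * b)) = integral {0..1} (\<lambda>w. max (w * a) ((1 - w) * b) * h w)"
    by (rule bounded_integral[where B="\<bar>a\<bar> + \<bar>b\<bar>"]) (auto intro!: max_weighted_bound)
  then show ?thesis unfolding L_def exponent_measure_inverse by simp
qed

lemma G1_0: "G1 0 = 1" and G_1: "G 1 = 1"
proof -
  have "integral {0..1} (\<lambda>w. h w - w * h w) = 1 - 1/2"
    using total_and_mean integrable_mult(1) bounded_integral(1)[of "\<lambda>w. 1" 1]
    by (subst Henstock_Kurzweil_Integration.integral_diff) auto
  then show "G 1 = 1" unfolding G_def by (simp add: algebra_simps)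
  show "G1 0 = 1" unfolding G1_def using total_and_mean by simp
qed

lemma G_compl: "1 - G r = 2 * integral {r..1} (\<lambda>w. (1 - w) * h w)"
  and G1_compl: "1 - G1 r = 2 * integral {0..r} (\<lambda>w. w * h w)" if "0 \<le> r" "r \<le> 1"
  using Henstock_Kurzweil_Integration.integral_combine[of 0 r 1, OF that integrable_mult(1)]
    Henstock_Kurzweil_Integration.integral_combine[of 0 r 1, OF that integrable_mult(2)] G_1 G1_0
  unfolding G_def G1_def by auto

lemma sub_integrable:
  fixes f :: "real \<Rightarrow> real"
  assumes "f integrable_on {0..1}" "0 \<le> x" "y \<le> 1"
  shows "f integrable_on {x..y}"
  using integrable_on_subinterval[OF assms(1), of x y] assms by auto

lemma tangent_integral:
  assumes "0 \<le> r" "r \<le> 1"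
  shows "a * G1 r + b * G r =
    2 * (integral {0..r} (\<lambda>w. (1 - w) * b * h w) + integral {r..1} (\<lambda>w. w * a * h w))"
proof -
  have *: "(\<lambda>w. (1 - w) * b * h w) = (\<lambda>w. b * ((1 - w) * h w))" "(\<lambda>w. w * a * h w) = (\<lambda>w. a * (w * h w))"
    by (auto simp: mult_ac)
  show ?thesis unfolding G_def G1_def * Henstock_Kurzweil_Integration.integral_mult_right by algebra
qed

lemma L_split:
  assumes "0 \<le> r" "r \<le> 1"
  shows "L a b = 2 * (integral {0..r} (\<lambda>w. max (w * a) ((1 - w) * b) * h w)
    + integral {r..1} (\<lambda>w. max (w * a) ((1 - w) * b) * h w))"
  unfolding L_eq using Henstock_Kurzweil_Integration.integral_combine[of 0 r 1, OF assms integrable_mult(3)]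
  by simp

text \<open>
Splitting the integral at an arbitrary point \<open>r\<close> and keeping one term of the maximum on either side
gives a linear minorant of \<open>L\<close>; it touches \<open>L\<close> when the split is at \<open>b / (a + b)\<close>.
\<close>
lemma L_ge_tangent:
  assumes r: "0 \<le> r" "r \<le> 1"
  shows "a * G1 r + b * G r \<le> L a b"
proof -
  have i: "(\<lambda>w. (1 - w) * b * h w) integrable_on {0..1}" "(\<lambda>w. w * a * h w) integrable_on {0..1}"
    using integrable_on_cmult_left[OF integrable_mult(1), of a]
      integrable_on_cmult_left[OF integrable_mult(2), of b] by (simp_all add: mult_ac)
  have "integral {0..r} (\<lambda>w. (1 - w) * b * h w) \<le> integral {0..r} (\<lambda>w. max (w * a) ((1 - w) * b) * h w)"
    using r h_nonneg
    by (intro integral_le sub_integrable[OF i(1)] sub_integrable[OF i(2)] sub_integrable[OF integrable_mult(3)]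
        mult_right_mono) auto
  moreover have "integral {r..1} (\<lambda>w. w * a * h w) \<le> integral {r..1} (\<lambda>w. max (w * a) ((1 - w) * b) * h w)"
    using r h_nonneg
    by (intro integral_le sub_integrable[OF i(1)] sub_integrable[OF i(2)] sub_integrable[OF integrable_mult(3)]
        mult_right_mono) auto
  ultimately show ?thesis unfolding tangent_integral[OF r] L_split[OF r] by simp
qed

lemma ratio_in_unit: "0 < b / (a + b)" "b / (a + b) < 1" if "0 < a" "0 < b" for a b :: real
  using that by (auto simp: field_simps)

lemma one_minus_ratio: "1 - b / (a + b) = a / (a + b)" if "0 < a" "0 < b" for a b :: real
  using that by (auto simp: field_simps)

lemma L_eq_tangent:
  assumes ab: "0 < a" "0 < b"
  shows "L a b = a * G1 (b / (a + b)) + b * G (b / (a + b))"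
proof -
  define r where "r = b / (a + b)"
  have r: "0 \<le> r" "r \<le> 1" using ratio_in_unit[OF ab] by (auto simp: r_def)
  have low: "w * a \<le> (1 - w) * b \<longleftrightarrow> w \<le> r" for w
    using ab by (simp add: r_def field_simps)
  have "integral {0..r} (\<lambda>w. (1 - w) * b * h w) = integral {0..r} (\<lambda>w. max (w * a) ((1 - w) * b) * h w)"
    by (intro integral_cong) (use low in \<open>auto simp: max_def\<close>)
  moreover have "integral {r..1} (\<lambda>w. w * a * h w) = integral {r..1} (\<lambda>w. max (w * a) ((1 - w) * b) * h w)"
  proof (intro integral_cong)
    fix w assume "w \<in> {r..1}"
    then have "\<not> w * a \<le> (1 - w) * b \<or> w = r" using low[of w] by auto
    moreover have "r * a = (1 - r) * b" using ab by (simp add: r_def field_simps)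
    ultimately show "w * a * h w = max (w * a) ((1 - w) * b) * h w" by (auto simp: max_def)
  qed
  ultimately show ?thesis unfolding r_def[symmetric] tangent_integral[OF r] L_split[OF r] by simp
qed

lemma L_ge: "a \<le> L a b" "b \<le> L a b"
  using L_ge_tangent[of 0 a b] L_ge_tangent[of 1 a b] G_1 G1_0 by (auto simp: G_def G1_def)

lemma L_homogeneous: "0 \<le> c \<Longrightarrow> L (c * a) (c * b) = c * L a b"
proof -
  assume c: "0 \<le> c"
  have "max (w * (c * a)) ((1 - w) * (c * b)) = c * max (w * a) ((1 - w) * b)" for w
    using c by (simp add: max_mult_distrib_left mult_ac)
  then show ?thesis unfolding L_eq by (simp add: mult_ac)
qed

lemma L_lipschitz: "L a b \<le> L a' b' + \<bar>a - a'\<bar> + \<bar>b - b'\<bar>"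
proof -
  have "integral {0..1} (\<lambda>w. max (w * a) ((1 - w) * b) * h w) \<le>
      integral {0..1} (\<lambda>w. max (w * a') ((1 - w) * b') * h w)
      + (\<bar>a - a'\<bar> * integral {0..1} (\<lambda>w. w * h w) + \<bar>b - b'\<bar> * integral {0..1} (\<lambda>w. (1 - w) * h w))"
  proof (rule has_integral_le)
    show "((\<lambda>w. max (w * a) ((1 - w) * b) * h w) has_integral
        integral {0..1} (\<lambda>w. max (w * a) ((1 - w) * b) * h w)) {0..1}"
      by (intro integrable_integral integrable_mult)
    show "((\<lambda>w. max (w * a') ((1 - w) * b') * h w
        + (\<bar>a - a'\<bar> * (w * h w) + \<bar>b - b'\<bar> * ((1 - w) * h w))) has_integral
      integral {0..1} (\<lambda>w. max (w * a') ((1 - w) * b') * h w)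
      + (\<bar>a - a'\<bar> * integral {0..1} (\<lambda>w. w * h w) + \<bar>b - b'\<bar> * integral {0..1} (\<lambda>w. (1 - w) * h w))) {0..1}"
      by (intro has_integral_add has_integral_mult_right integrable_integral integrable_mult)
    fix w :: real assume w: "w \<in> {0..1}"
    have "w * a - w * a' \<le> w * \<bar>a - a'\<bar>" "(1 - w) * b - (1 - w) * b' \<le> (1 - w) * \<bar>b - b'\<bar>"
      unfolding right_diff_distrib[symmetric] using w by (auto intro!: mult_left_mono)
    moreover have "0 \<le> w * \<bar>a - a'\<bar>" "0 \<le> (1 - w) * \<bar>b - b'\<bar>" using w by auto
    ultimately have "max (w * a) ((1 - w) * b) \<le> max (w * a') ((1 - w) * b') + (w * \<bar>a - a'\<bar> + (1 - w) * \<bar>b - b'\<bar>)"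
      by linarith
    then have "max (w * a) ((1 - w) * b) * h w \<le>
        (max (w * a') ((1 - w) * b') + (w * \<bar>a - a'\<bar> + (1 - w) * \<bar>b - b'\<bar>)) * h w"
      using h_nonneg by (rule mult_right_mono)
    then show "max (w * a) ((1 - w) * b) * h w \<le> max (w * a') ((1 - w) * b') * h w
        + (\<bar>a - a'\<bar> * (w * h w) + \<bar>b - b'\<bar> * ((1 - w) * h w))"
      by (simp add: algebra_simps)
  qed
  moreover have "integral {0..1} (\<lambda>w. (1 - w) * h w) = 1/2" using G_1 unfolding G_def by simp
  ultimately show ?thesis unfolding L_eq total_and_mean(2) by simp
qed

lemma V_eq: "exponent_measure H x y = L (inverse x) (inverse y)"
  by (simp add: L_def)

lemma deriv_inverse_arg:
  assumes f: "(f has_real_derivative d) (at (inverse x))" and x: "0 < x"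
  shows "((\<lambda>y. f (inverse y)) has_real_derivative - d * inverse (x\<^sup>2)) (at x)"
proof -
  have "(inverse has_real_derivative - inverse (x\<^sup>2)) (at x)"
    using DERIV_inverse[of x UNIV] x by (simp add: power2_eq_square numeral_2_eq_2)
  from DERIV_chain2[OF f this] show ?thesis by simp
qed

lemma L_deriv2: "((\<lambda>y. L a y) has_real_derivative G (b / (a + b))) (at b)"
  and L_deriv1: "((\<lambda>x. L x b) has_real_derivative G1 (b / (a + b))) (at a)" if ab: "0 < a" "0 < b"
proof -
  have r: "0 \<le> b / (a + b)" "b / (a + b) \<le> 1" using ratio_in_unit[OF ab] by auto
  have "(\<lambda>y'. exponent_measure H (inverse a) y') differentiable (at (inverse b))"
    using partials ab unfolding has_partial_derivs_def by auto
  then obtain d where "((\<lambda>y'. exponent_measure H (inverse a) y') has_real_derivative d) (at (inverse b))"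
    using real_differentiable_def by blast
  from deriv_inverse_arg[OF this ab(2)]
  have *: "((\<lambda>y. L a y) has_real_derivative - d * inverse (b\<^sup>2)) (at b)" by (simp add: V_eq)
  have "- d * inverse (b\<^sup>2) = G (b / (a + b))"
    by (rule derivative_eq_tangent[OF * ab(2) L_ge_tangent[OF r] L_eq_tangent[OF ab]])
  with * show "((\<lambda>y. L a y) has_real_derivative G (b / (a + b))) (at b)" by simp
  have "(\<lambda>x'. exponent_measure H x' (inverse b)) differentiable (at (inverse a))"
    using partials ab unfolding has_partial_derivs_def by auto
  then obtain d where "((\<lambda>x'. exponent_measure H x' (inverse b)) has_real_derivative d) (at (inverse a))"
    using real_differentiable_def by blast
  from deriv_inverse_arg[OF this ab(1)]
  have *: "((\<lambda>x. L x b) has_real_derivative - d * inverse (a\<^sup>2)) (at a)" by (simp add: V_eq)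
  have "- d * inverse (a\<^sup>2) = G1 (b / (a + b))"
    by (rule derivative_eq_tangent[where c="b * G (b / (a + b))", OF * ab(1)])
       (use L_ge_tangent[OF r] L_eq_tangent[OF ab] in \<open>auto simp: add.commute\<close>)
  with * show "((\<lambda>x. L x b) has_real_derivative G1 (b / (a + b))) (at a)" by simp
qed

text \<open>
The derivative of \<open>V\<close> in the second argument at \<open>(x, 1)\<close> is \<open>- G (x / (1 + x))\<close>, so the existence of the
mixed derivative of \<open>V\<close> makes \<open>G\<close> differentiable at every point of the open unit interval.
\<close>
lemma G_differentiable:
  assumes r: "0 < r" "r < 1"
  shows "(G has_real_derivative deriv G r) (at r)"
proof -
  define x where "x = r / (1 - r)"
  have x: "0 < x" using r by (simp add: x_def)
  define Q where "Q = (\<lambda>x'. deriv (\<lambda>y'. exponent_measure H x' y') 1)"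
  have "Q differentiable (at x)" using partials x unfolding has_partial_derivs_def Q_def by auto
  then obtain d where d: "(Q has_real_derivative d) (at x)" using real_differentiable_def by blast
  have Q: "Q x' = - G (x' / (1 + x'))" if "0 < x'" for x'
  proof -
    have "((\<lambda>y. L (inverse x') y) has_real_derivative G (1 / (inverse x' + 1))) (at (inverse 1))"
      using L_deriv2[of "inverse x'" 1] that by simp
    from deriv_inverse_arg[OF this]
    have "((\<lambda>y. L (inverse x') (inverse y)) has_real_derivative - G (1 / (inverse x' + 1))) (at 1)"
      by simp
    moreover have "1 / (inverse x' + 1) = x' / (1 + x')" using that by (simp add: field_simps)
    ultimately show ?thesis unfolding Q_def V_eq by (auto intro!: DERIV_imp_deriv)
  qed
  have ratio: "(\<rho> / (1 - \<rho>)) / (1 + \<rho> / (1 - \<rho>)) = \<rho>" if "\<rho> < 1" for \<rho> :: real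
  proof -
    have "1 + \<rho> / (1 - \<rho>) = 1 / (1 - \<rho>)" using that by (simp add: field_simps)
    then show ?thesis using that by simp
  qed
  have "((\<lambda>\<rho>. \<rho> / (1 - \<rho>)) has_real_derivative 1 / (1 - r)\<^sup>2) (at r)"
    using r by (auto intro!: derivative_eq_intros simp: power2_eq_square field_simps)
  from DERIV_minus[OF DERIV_chain2[OF d[unfolded x_def] this]]
  have "((\<lambda>\<rho>. - Q (\<rho> / (1 - \<rho>))) has_real_derivative - (d * (1 / (1 - r)\<^sup>2))) (at r)" .
  then have "(G has_real_derivative - (d * (1 / (1 - r)\<^sup>2))) (at r)"
    by (rule has_field_derivative_transform_within_open[where S="{0<..<1}"])
       (use r Q ratio in auto)
  then show ?thesis using DERIV_imp_deriv by metis
qed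

definition D :: "real \<Rightarrow> real \<Rightarrow> real" where
  "D a b = deriv G (b / (a + b)) * (b / (a + b)\<^sup>2)"

lemma G_ratio_deriv1:
  assumes ab: "0 < a" "0 < b"
  shows "((\<lambda>x. G (b / (x + b))) has_real_derivative - D a b) (at a)"
proof -
  have "((\<lambda>x. b / (x + b)) has_real_derivative - (b / (a + b)\<^sup>2)) (at a)"
    using ab by (auto intro!: derivative_eq_intros simp: power2_eq_square)
  from DERIV_chain2[OF G_differentiable[OF ratio_in_unit[OF ab]] this] show ?thesis
    by (simp add: D_def)
qed

text \<open>
By Euler's relation \<open>a * La = L - b * Lb\<close>, so the derivative of \<open>La\<close> in \<open>b\<close> follows from
those of \<open>L\<close> and \<open>Lb\<close> and agrees with the derivative of \<open>Lb\<close> in \<open>a\<close>.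
\<close>
lemma G1_ratio_deriv2:
  assumes ab: "0 < a" "0 < b"
  shows "((\<lambda>y. G1 (y / (a + y))) has_real_derivative - D a b) (at b)"
proof -
  have "((\<lambda>y. y / (a + y)) has_real_derivative a / (a + b)\<^sup>2) (at b)"
    using ab by (auto intro!: derivative_eq_intros simp: power2_eq_square field_simps)
  from DERIV_chain2[OF G_differentiable[OF ratio_in_unit[OF ab]] this]
  have "((\<lambda>y. G (y / (a + y))) has_real_derivative deriv G (b / (a + b)) * (a / (a + b)\<^sup>2)) (at b)" .
  then have "((\<lambda>y. (L a y - y * G (y / (a + y))) / a) has_real_derivative
      (G (b / (a + b)) - (1 * G (b / (a + b)) + deriv G (b / (a + b)) * (a / (a + b)\<^sup>2) * b)) / a) (at b)"
    by (intro DERIV_cdivide DERIV_diff DERIV_mult L_deriv2 ab DERIV_ident)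
  moreover have "(G (b / (a + b)) - (1 * G (b / (a + b)) + deriv G (b / (a + b)) * (a / (a + b)\<^sup>2) * b)) / a = - D a b"
    using ab by (simp add: D_def)
  ultimately have "((\<lambda>y. (L a y - y * G (y / (a + y))) / a) has_real_derivative - D a b) (at b)"
    by simp
  then show ?thesis
    by (rule has_field_derivative_transform_within_open[where S="{0<..}"])
       (use ab L_eq_tangent in \<open>auto simp: field_simps\<close>)
qed

lemma stdf_exists: "\<exists>K. stdf L (\<lambda>a b. G1 (b / (a + b))) (\<lambda>a b. G (b / (a + b))) D s1 s2 K"
proof -
  have s: "s1 > -1" "s2 > -1" using tails unfolding spectral_tails_def by auto
  obtain K0 where K0: "K0 \<ge> 1" "\<And>w. 0 < w \<Longrightarrow> w < 1 \<Longrightarrow> comparable K0 (h w) (w powr s2 * (1 - w) powr s1)"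
    using density_comparable[OF tails h_nonneg lbp] by blast
  have cl: "comparable K0 (w * h w) (w powr (1 + s2) * (1 - w) powr s1)" if "0 < w" "w < 1" for w
    using comparable_cmult[OF K0(2)[OF that], of w] that by (simp add: powr_add mult_ac)
  have cr: "comparable K0 ((1 - w) * h w) (w powr s2 * (1 - w) powr (1 + s1))" if "0 < w" "w < 1" for w
    using comparable_cmult[OF K0(2)[OF that], of "1 - w"] that by (simp add: powr_add mult_ac)
  have nn: "0 \<le> w * h w" "0 \<le> (1 - w) * h w" if "w \<in> {0..1}" for w
    using that h_nonneg by auto
  have s': "1 + s1 > -1" "1 + s2 > -1" using s by auto
  obtain K1 where K1: "K1 \<ge> 1" "\<And>r. 0 < r \<Longrightarrow> r < 1 \<Longrightarrow>
      comparable K1 (integral {r..1} (\<lambda>w. w * h w)) ((1 - r) powr (1 + s1))"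
    using integral_power_comparable'[OF integrable_mult(1) nn(1) K0(1) s(1) cl] by blast
  obtain K2 where K2: "K2 \<ge> 1" "\<And>r. 0 < r \<Longrightarrow> r < 1 \<Longrightarrow>
      comparable K2 (integral {0..r} (\<lambda>w. (1 - w) * h w)) (r powr (1 + s2))"
    using integral_power_comparable[OF integrable_mult(2) nn(2) K0(1) s(2) cr] by blast
  obtain K3 where K3: "K3 \<ge> 1" "\<And>r. 0 < r \<Longrightarrow> r < 1 \<Longrightarrow>
      comparable K3 (integral {0..r} (\<lambda>w. w * h w)) (r powr (1 + (1 + s2)))"
    using integral_power_comparable[OF integrable_mult(1) nn(1) K0(1) s'(2) cl] by blast
  obtain K4 where K4: "K4 \<ge> 1" "\<And>r. 0 < r \<Longrightarrow> r < 1 \<Longrightarrow>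
      comparable K4 (integral {r..1} (\<lambda>w. (1 - w) * h w)) ((1 - r) powr (1 + (1 + s1)))"
    using integral_power_comparable'[OF integrable_mult(2) nn(2) K0(1) s'(1) cr] by blast
  define K where "K = 2 * Max {K0, K1, K2, K3, K4}"
  have K: "2 * K0 \<le> K" "2 * K1 \<le> K" "2 * K2 \<le> K" "2 * K3 \<le> K" "2 * K4 \<le> K"
    unfolding K_def by (rule mult_left_mono[OF Max_ge]; simp)+
  have twice: "comparable K (2 * x) y" if "comparable K' x y" "1 \<le> K'" "2 * K' \<le> K" "0 \<le> y" for K' x y
  proof -
    have "comparable (2 * K') (2 * x) (1 * y)"
      by (rule comparable_mult[OF _ that(1)]) (use that in \<open>auto simp: comparable_def\<close>)
    then have "comparable (2 * K') (2 * x) y" by simp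
    then show ?thesis by (rule comparable_mono) (use that in auto)
  qed
  have Gd: "comparable K (deriv G r) (r powr s2 * (1 - r) powr (1 + s1))" if r: "0 < r" "r < 1" for r
  proof (rule derivative_comparable[OF r G_differentiable[OF r]])
    fix x y :: real assume xy: "0 < x" "x \<le> y" "y < 1"
    have "(\<lambda>w. (1 - w) * h w) integrable_on {0..y}" "(\<lambda>w. (1 - w) * h w) integrable_on {x..y}"
      using xy by (intro sub_integrable[OF integrable_mult(2)]; simp)+
    then have "G y - G x = 2 * integral {x..y} (\<lambda>w. (1 - w) * h w)"
        "((\<lambda>w. (1 - w) * h w) has_integral integral {x..y} (\<lambda>w. (1 - w) * h w)) {x..y}"
      unfolding G_def using Henstock_Kurzweil_Integration.integral_combine[of 0 x y "\<lambda>w. (1 - w) * h w"] xy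
      by auto
    then show "((\<lambda>w. 2 * ((1 - w) * h w)) has_integral G y - G x) {x..y}"
      by (auto intro!: has_integral_mult_right)
  next
    fix w :: real assume "0 < w" "w < 1"
    then show "comparable K (2 * ((1 - w) * h w)) (w powr s2 * (1 - w) powr (1 + s1))"
      using cr K K0 by (intro twice[of K0]) auto
  next
    show "continuous_on {0<..<1} (\<lambda>w. w powr s2 * (1 - w) powr (1 + s1))"
      by (intro continuous_intros) auto
  qed
  have "stdf L (\<lambda>a b. G1 (b / (a + b))) (\<lambda>a b. G (b / (a + b))) D s1 s2 K"
  proof
    show "s1 > -1" "s2 > -1" "1 \<le> K" using s K K0 by auto
    show "0 \<le> c \<Longrightarrow> L (c * a) (c * b) = c * L a b" for a b c by (rule L_homogeneous)
    show "a \<le> L a b" "b \<le> L a b" for a b by (rule L_ge)+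
    show "L a b \<le> L a' b' + \<bar>a - a'\<bar> + \<bar>b - b'\<bar>" for a b a' b' by (rule L_lipschitz)
    fix a b :: real
    have hom: "c * b / (c * a + c * b) = b / (a + b)" if "0 < c" for c
      using that by (simp flip: distrib_left)
    show "0 < c \<Longrightarrow> G1 (c * b / (c * a + c * b)) = G1 (b / (a + b))"
      "0 < c \<Longrightarrow> G (c * b / (c * a + c * b)) = G (b / (a + b))" for c by (simp_all add: hom)
    assume ab: "0 < a" "0 < b"
    note r = ratio_in_unit[OF ab]
    note r' = less_imp_le[OF r(1)] less_imp_le[OF r(2)]
    show "L a b = a * G1 (b / (a + b)) + b * G (b / (a + b))" by (rule L_eq_tangent[OF ab])
    show "((\<lambda>x. L x b) has_real_derivative G1 (b / (a + b))) (at a)"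
      "((\<lambda>y. L a y) has_real_derivative G (b / (a + b))) (at b)"
      by (rule L_deriv1[OF ab] L_deriv2[OF ab])+
    show "((\<lambda>y. G1 (y / (a + y))) has_real_derivative - D a b) (at b)" by (rule G1_ratio_deriv2[OF ab])
    show "((\<lambda>x. G (b / (x + b))) has_real_derivative - D a b) (at a)" by (rule G_ratio_deriv1[OF ab])
    have "comparable K (G1 (b / (a + b))) ((1 - b / (a + b)) powr (1 + s1))"
      unfolding G1_def using K K1 r by (intro twice[of K1]) auto
    then show "comparable K (G1 (b / (a + b))) ((a / (a + b)) powr (1 + s1))"
      by (simp add: one_minus_ratio ab)
    show "comparable K (G (b / (a + b))) ((b / (a + b)) powr (1 + s2))"
      unfolding G_def using K K2 r by (intro twice[of K2]) auto
    have "comparable K (1 - G1 (b / (a + b))) ((b / (a + b)) powr (1 + (1 + s2)))"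
      unfolding G1_compl[OF r'] using K K3 r by (intro twice[of K3]) auto
    then show "comparable K (1 - G1 (b / (a + b))) ((b / (a + b)) powr (2 + s2))" by simp
    have "comparable K (1 - G (b / (a + b))) ((1 - b / (a + b)) powr (1 + (1 + s1)))"
      unfolding G_compl[OF r'] using K K4 r by (intro twice[of K4]) auto
    then show "comparable K (1 - G (b / (a + b))) ((a / (a + b)) powr (2 + s1))"
      by (simp add: one_minus_ratio ab)
    have "comparable K (b / (a + b) * deriv G (b / (a + b)))
        (b / (a + b) * ((b / (a + b)) powr s2 * (1 - b / (a + b)) powr (1 + s1)))"
      using Gd[OF r] r by (intro comparable_cmult) auto
    moreover have "(a + b) * D a b = b / (a + b) * deriv G (b / (a + b))"
      using ab by (simp add: D_def power2_eq_square)
    moreover have "b / (a + b) * ((b / (a + b)) powr s2 * (1 - b / (a + b)) powr (1 + s1)) =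
        (a / (a + b)) powr (1 + s1) * (b / (a + b)) powr (1 + s2)"
      using r ab by (simp add: one_minus_ratio[OF ab] powr_add mult_ac)
    ultimately show "comparable K ((a + b) * D a b) ((a / (a + b)) powr (1 + s1) * (b / (a + b)) powr (1 + s2))"
      by simp
  qed
  then show ?thesis by blast
qed

end

section \<open>Exponential rates\<close>

text \<open>
Exponential growth rates, in which the gauge function is minus the rate of the density along
a ray. Comparable functions have equal rates, so constants and
factors of polynomial growth disappear.
\<close>
definition has_rate :: "(real \<Rightarrow> real) \<Rightarrow> real \<Rightarrow> bool" where
  "has_rate F \<rho> \<longleftrightarrow> (\<forall>\<^sub>F t in at_top. 0 < F t) \<and> ((\<lambda>t. ln (F t) / t) \<longlongrightarrow> \<rho>) at_top"

lemma has_rateD: "has_rate F \<rho> \<Longrightarrow> \<forall>\<^sub>F t in at_top. 0 < F t"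
  by (simp add: has_rate_def)

lemma has_rate_exp:
  assumes "((\<lambda>t. \<phi> t / t) \<longlongrightarrow> \<rho>) at_top"
  shows "has_rate (\<lambda>t. exp (\<phi> t)) \<rho>"
  using assms by (simp add: has_rate_def)

lemma has_rate_const: "0 < c \<Longrightarrow> has_rate (\<lambda>t. c) 0"
  unfolding has_rate_def by (auto intro!: tendsto_divide_0 tendsto_const filterlim_at_top_imp_at_infinity filterlim_ident)

lemma has_rate_mult:
  assumes "has_rate F \<rho>" "has_rate G \<sigma>"
  shows "has_rate (\<lambda>t. F t * G t) (\<rho> + \<sigma>)"
proof -
  have e: "\<forall>\<^sub>F t in at_top. 0 < F t \<and> 0 < G t"
    using assms by (auto simp: has_rate_def eventually_conj_iff)
  have "((\<lambda>t. ln (F t) / t + ln (G t) / t) \<longlongrightarrow> \<rho> + \<sigma>) at_top"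
    using assms by (intro tendsto_add) (auto simp: has_rate_def)
  then have "((\<lambda>t. ln (F t * G t) / t) \<longlongrightarrow> \<rho> + \<sigma>) at_top"
    by (rule Lim_transform_eventually)
       (use e in eventually_elim, auto simp: ln_mult add_divide_distrib)
  moreover have "\<forall>\<^sub>F t in at_top. 0 < F t * G t" using e by eventually_elim auto
  ultimately show ?thesis unfolding has_rate_def by blast
qed

lemma has_rate_powr:
  assumes "has_rate F \<rho>"
  shows "has_rate (\<lambda>t. F t powr s) (s * \<rho>)"
proof -
  have e: "\<forall>\<^sub>F t in at_top. 0 < F t" using assms by (rule has_rateD)
  have "((\<lambda>t. s * (ln (F t) / t)) \<longlongrightarrow> s * \<rho>) at_top"
    using assms by (intro tendsto_mult tendsto_const) (auto simp: has_rate_def)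
  then have "((\<lambda>t. ln (F t powr s) / t) \<longlongrightarrow> s * \<rho>) at_top"
    by (rule Lim_transform_eventually)
       (use e in eventually_elim, auto simp: ln_powr)
  moreover have "\<forall>\<^sub>F t in at_top. 0 < F t powr s" using e by eventually_elim auto
  ultimately show ?thesis unfolding has_rate_def by blast
qed

lemma has_rate_inverse:
  assumes "has_rate F \<rho>"
  shows "has_rate (\<lambda>t. inverse (F t)) (- \<rho>)"
proof -
  have e: "\<forall>\<^sub>F t in at_top. 0 < F t" using assms by (rule has_rateD)
  have "((\<lambda>t. - (ln (F t) / t)) \<longlongrightarrow> - \<rho>) at_top"
    using assms by (intro tendsto_minus) (auto simp: has_rate_def)
  then have "((\<lambda>t. ln (inverse (F t)) / t) \<longlongrightarrow> - \<rho>) at_top"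
    by (rule Lim_transform_eventually)
       (use e in eventually_elim, auto simp: ln_inverse)
  moreover have "\<forall>\<^sub>F t in at_top. 0 < inverse (F t)" using e by eventually_elim auto
  ultimately show ?thesis unfolding has_rate_def by blast
qed

lemma has_rate_divide:
  assumes "has_rate F \<rho>" "has_rate G \<sigma>"
  shows "has_rate (\<lambda>t. F t / G t) (\<rho> - \<sigma>)"
  using has_rate_mult[OF assms(1) has_rate_inverse[OF assms(2)]] by (simp add: divide_inverse)

lemma has_rate_squeeze:
  assumes "has_rate F \<rho>" "has_rate G \<rho>" "\<forall>\<^sub>F t in at_top. F t \<le> E t \<and> E t \<le> G t"
  shows "has_rate E \<rho>"
proof -
  have e: "\<forall>\<^sub>F t in at_top. 0 < F t" using assms(1) by (rule has_rateD)
  have pos: "\<forall>\<^sub>F t in at_top. 0 < E t" using e assms(3) by eventually_elim auto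
  have "((\<lambda>t. ln (E t) / t) \<longlongrightarrow> \<rho>) at_top"
  proof (rule tendsto_sandwich)
    show "\<forall>\<^sub>F t in at_top. ln (F t) / t \<le> ln (E t) / t"
      using e assms(3) eventually_gt_at_top[of 0] by eventually_elim (auto intro!: divide_right_mono)
    show "\<forall>\<^sub>F t in at_top. ln (E t) / t \<le> ln (G t) / t"
      using pos assms(3) eventually_gt_at_top[of 0] by eventually_elim (auto intro!: divide_right_mono)
  qed (use assms in \<open>auto simp: has_rate_def\<close>)
  with pos show ?thesis by (simp add: has_rate_def)
qed

lemma has_rate_cmult:
  assumes "has_rate F \<rho>" "0 < c"
  shows "has_rate (\<lambda>t. c * F t) \<rho>"
  using has_rate_mult[OF has_rate_const[OF assms(2)] assms(1)] by simp

lemma has_rate_comparable: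
  assumes "has_rate G \<rho>" "0 < K" "\<forall>\<^sub>F t in at_top. comparable K (F t) (G t)"
  shows "has_rate F \<rho>"
proof (rule has_rate_squeeze)
  show "has_rate (\<lambda>t. (1 / K) * G t) \<rho>" "has_rate (\<lambda>t. K * G t) \<rho>"
    using assms by (auto intro!: has_rate_cmult simp del: times_divide_eq_left)
  show "\<forall>\<^sub>F t in at_top. 1 / K * G t \<le> F t \<and> F t \<le> K * G t"
    using assms(3) by (simp add: comparable_def)
qed

lemma has_rate_add:
  assumes "has_rate F \<rho>" "has_rate G \<sigma>"
  shows "has_rate (\<lambda>t. F t + G t) (max \<rho> \<sigma>)"
proof (rule has_rate_squeeze)
  have e: "\<forall>\<^sub>F t in at_top. 0 < F t \<and> 0 < G t"
    using assms by (auto simp: has_rate_def eventually_conj_iff)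
  have "((\<lambda>t. max (ln (F t) / t) (ln (G t) / t)) \<longlongrightarrow> max \<rho> \<sigma>) at_top"
    using assms by (intro tendsto_max) (auto simp: has_rate_def)
  then have "((\<lambda>t. ln (max (F t) (G t)) / t) \<longlongrightarrow> max \<rho> \<sigma>) at_top"
    by (rule Lim_transform_eventually)
       (use e eventually_gt_at_top[of 0] in eventually_elim,
         auto simp: max_def divide_le_cancel dest: ln_mono)
  moreover have "\<forall>\<^sub>F t in at_top. 0 < max (F t) (G t)" using e by eventually_elim auto
  ultimately show *: "has_rate (\<lambda>t. max (F t) (G t)) (max \<rho> \<sigma>)" unfolding has_rate_def by blast
  show "has_rate (\<lambda>t. 2 * max (F t) (G t)) (max \<rho> \<sigma>)" by (rule has_rate_cmult[OF *]) simp
  show "\<forall>\<^sub>F t in at_top. max (F t) (G t) \<le> F t + G t \<and> F t + G t \<le> 2 * max (F t) (G t)"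
    using e by eventually_elim auto
qed

text \<open>
The level \<open>- ln (1 - F)\<close> behaves like \<open>F\<close> when \<open>F\<close> is small and grows linearly when \<open>1 - F\<close> is
exponentially small. In both situations its rate is that of \<open>F\<close>, since linear growth has rate 0.
\<close>
lemma has_rate_neg_ln:
  assumes F: "has_rate F \<phi>" and G: "has_rate (\<lambda>t. 1 - F t) (- \<psi>)" and z: "\<phi> = 0 \<or> \<psi> = 0"
    and \<psi>: "0 \<le> \<psi>"
  shows "has_rate (\<lambda>t. - ln (1 - F t)) \<phi>" "((\<lambda>t. - ln (1 - F t) / t) \<longlongrightarrow> \<psi>) at_top"
proof -
  have e: "\<forall>\<^sub>F t in at_top. 0 < F t \<and> 0 < 1 - F t"
    using F G by (auto simp: has_rate_def eventually_conj_iff)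
  show lim: "((\<lambda>t. - ln (1 - F t) / t) \<longlongrightarrow> \<psi>) at_top"
    using G tendsto_minus[of "\<lambda>t. ln (1 - F t) / t" "- \<psi>" at_top] by (simp add: has_rate_def)
  have low: "\<forall>\<^sub>F t in at_top. F t \<le> - ln (1 - F t)"
    using e
  proof eventually_elim
    case (elim t)
    then show ?case using ln_le_minus_one[of "1 - F t"] by linarith
  qed
  from z show "has_rate (\<lambda>t. - ln (1 - F t)) \<phi>"
  proof
    assume 0: "\<psi> = 0"
    show ?thesis
    proof (rule has_rate_squeeze[OF F])
      show "has_rate (\<lambda>t. F t / (1 - F t)) \<phi>" using has_rate_divide[OF F G] 0 by simp
      show "\<forall>\<^sub>F t in at_top. F t \<le> - ln (1 - F t) \<and> - ln (1 - F t) \<le> F t / (1 - F t)"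
        using e low
      proof eventually_elim
        case (elim t)
        have "- ln (1 - F t) = ln (inverse (1 - F t))" using elim by (simp add: ln_inverse)
        also have "\<dots> \<le> inverse (1 - F t) - 1" using elim by (intro ln_le_minus_one) auto
        also have "\<dots> = F t / (1 - F t)" using elim by (simp add: field_simps)
        finally show ?case using elim by simp
      qed
    qed
  next
    assume 0: "\<phi> = 0"
    have lin: "has_rate (\<lambda>t. (\<psi> + 1) * t) 0"
    proof -
      have "((\<lambda>t::real. ln t / t) \<longlongrightarrow> 0) at_top" by (rule ln_x_over_x_tendsto_0)
      then have "has_rate (\<lambda>t. t) 0" unfolding has_rate_def using eventually_gt_at_top by auto
      then show ?thesis using \<psi> by (intro has_rate_cmult) auto
    qed
    show ?thesis
    proof (rule has_rate_squeeze[OF F])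
      show "has_rate (\<lambda>t. (\<psi> + 1) * t) \<phi>" using lin 0 by simp
      have "\<forall>\<^sub>F t in at_top. - ln (1 - F t) / t < \<psi> + 1" using order_tendstoD(2)[OF lim] by simp
      then show "\<forall>\<^sub>F t in at_top. F t \<le> - ln (1 - F t) \<and> - ln (1 - F t) \<le> (\<psi> + 1) * t"
        using low eventually_gt_at_top[of 0] by eventually_elim (auto simp: field_simps)
    qed
  qed
qed

text \<open>
The contribution to the gauge function of a copula density whose arguments are at levels with
rates \<open>- x\<close> and \<open>- y\<close>: the powers of \<open>a / (a + b)\<close> and \<open>b / (a + b)\<close> give the first two terms and the
factor \<open>1 + 1 / (a + b)\<close> the last one.
\<close>
definition pair_gauge :: "real \<Rightarrow> real \<Rightarrow> real \<Rightarrow> real \<Rightarrow> real" where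
  "pair_gauge s s' x y = (1 + s) * (x - min x y) + (1 + s') * (y - min x y) - min x y"

definition exp_level :: "real \<Rightarrow> real" where
  "exp_level x = - ln (exp_cdf x)"

lemma exp_cdf_in_unit: "0 < x \<Longrightarrow> 0 < exp_cdf x" "exp_cdf x < 1"
  by (auto simp: exp_cdf_def)

lemma exp_level_pos: "0 < x \<Longrightarrow> 0 < exp_level x"
  using exp_cdf_in_unit[of x] by (simp add: exp_level_def)

lemma exp_level_lower: "0 < x \<Longrightarrow> exp (- x) \<le> exp_level x"
  using ln_le_minus_one[of "exp_cdf x"] exp_cdf_in_unit[of x] by (simp add: exp_level_def exp_cdf_def)

lemma exp_level_upper:
  assumes "ln 2 \<le> x"
  shows "exp_level x \<le> 2 * exp (- x)"
proof -
  have "0 < x" using assms ln_gt_zero[of 2] by linarith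
  note u = exp_cdf_in_unit(1)[OF this]
  have "exp (- x) \<le> exp (- ln 2)" using assms by simp
  also have "\<dots> = 1 / 2" by (simp add: exp_minus)
  finally have half: "exp (- x) \<le> 1 / 2" .
  have "exp_level x = ln (inverse (exp_cdf x))" using u by (simp add: exp_level_def ln_inverse)
  also have "\<dots> \<le> inverse (exp_cdf x) - 1" using u by (intro ln_le_minus_one) auto
  also have "\<dots> = exp (- x) / (1 - exp (- x))" using u unfolding exp_cdf_def by (simp add: field_simps)
  also have "\<dots> \<le> exp (- x) / (1 / 2)" using half \<open>0 < x\<close> by (intro divide_left_mono) auto
  finally show ?thesis by simp
qed

lemma exp_level_tendsto: "(exp_level \<longlongrightarrow> 0) at_top"
proof (rule tendsto_sandwich)
  show "\<forall>\<^sub>F x in at_top. 0 \<le> exp_level x"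
    using eventually_gt_at_top[of 0] by eventually_elim (simp add: exp_level_pos less_imp_le)
  show "\<forall>\<^sub>F x in at_top. exp_level x \<le> 2 * exp (- x)"
    using eventually_ge_at_top[of "ln 2"] by eventually_elim (rule exp_level_upper)
  have "((\<lambda>x::real. exp (- x)) \<longlongrightarrow> 0) at_top"
    by (intro filterlim_compose[OF exp_at_bot] filterlim_uminus_at_bot_at_top)
  from tendsto_mult[OF tendsto_const[of 2] this] show "((\<lambda>x::real. 2 * exp (- x)) \<longlongrightarrow> 0) at_top" by simp
qed simp

lemma exp_level_rate:
  assumes "0 < x"
  shows "has_rate (\<lambda>t. exp_level (t * x)) (- x)"
proof (rule has_rate_squeeze)
  have "((\<lambda>t. - (t * x) / t) \<longlongrightarrow> - x) at_top"
    by (rule Lim_transform_eventually[OF tendsto_const])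
       (use eventually_gt_at_top[of "0::real"] in eventually_elim, auto)
  then show *: "has_rate (\<lambda>t. exp (- (t * x))) (- x)" by (rule has_rate_exp)
  show "has_rate (\<lambda>t. 2 * exp (- (t * x))) (- x)" by (rule has_rate_cmult[OF *]) simp
  have "\<forall>\<^sub>F t in at_top. ln 2 / x \<le> t" by (rule eventually_ge_at_top)
  then show "\<forall>\<^sub>F t in at_top. exp (- (t * x)) \<le> exp_level (t * x) \<and> exp_level (t * x) \<le> 2 * exp (- (t * x))"
    using eventually_gt_at_top[of 0]
    by eventually_elim
       (use assms in \<open>auto intro!: exp_level_lower exp_level_upper simp: field_simps\<close>)
qed

lemma exp_level_deriv:
  assumes "0 < x"
  shows "(exp_level has_real_derivative - (exp (- x) / exp_cdf x)) (at x)"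
proof -
  have "((\<lambda>x. - ln (1 - exp (- x))) has_real_derivative - (exp (- x) / (1 - exp (- x)))) (at x)"
    using assms by (auto intro!: derivative_eq_intros)
  then show ?thesis unfolding exp_level_def[abs_def] exp_cdf_def .
qed

section \<open>Rates of copula densities and conditional distributions\<close>

context stdf
begin

lemma ratio_pos: "0 < a \<Longrightarrow> 0 < b \<Longrightarrow> 0 < a / (a + b)" "0 < a \<Longrightarrow> 0 < b \<Longrightarrow> 0 < b / (a + b)" for a b :: real
  by auto

lemma La_pos: "0 < a \<Longrightarrow> 0 < b \<Longrightarrow> 0 < La a b"
  using comparable_pos[OF La_bound[of a b]] K ratio_pos[of a b] by auto

lemma Lb_pos: "0 < a \<Longrightarrow> 0 < b \<Longrightarrow> 0 < Lb a b"
  using comparable_pos[OF Lb_bound[of a b]] K ratio_pos[of a b] by auto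

lemma Lb_lt_1: "0 < a \<Longrightarrow> 0 < b \<Longrightarrow> Lb a b < 1"
  using comparable_pos[OF Lb_bound'[of a b]] K ratio_pos[of a b] by auto

lemma D_pos: "0 < a \<Longrightarrow> 0 < b \<Longrightarrow> 0 < D a b"
  using comparable_pos[OF D_bound[of a b]] K ratio_pos[of a b] by (auto simp: zero_less_mult_iff)

lemma L_0_0: "L 0 0 = 0"
  using L_homogeneous[of 0 0 0] by simp

lemma L_le: "0 \<le> a \<Longrightarrow> 0 \<le> b \<Longrightarrow> L a b \<le> a + b"
  using L_lipschitz[of a b 0 0] L_0_0 by simp

lemma tendsto_L:
  assumes "(f \<longlongrightarrow> a) F" "(g \<longlongrightarrow> b) F"
  shows "((\<lambda>t. L (f t) (g t)) \<longlongrightarrow> L a b) F"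
proof -
  have "((\<lambda>t. \<bar>f t - a\<bar> + \<bar>g t - b\<bar>) \<longlongrightarrow> \<bar>a - a\<bar> + \<bar>b - b\<bar>) F"
    by (intro tendsto_intros assms)
  then have "((\<lambda>t. \<bar>f t - a\<bar> + \<bar>g t - b\<bar>) \<longlongrightarrow> 0) F" by simp
  then show ?thesis
  proof (rule Lim_transform_bound[rotated, THEN LIM_zero_cancel])
    show "\<forall>\<^sub>F t in F. norm (L (f t) (g t) - L a b) \<le> norm (\<bar>f t - a\<bar> + \<bar>g t - b\<bar>)"
    proof (intro always_eventually allI)
      fix t
      show "norm (L (f t) (g t) - L a b) \<le> norm (\<bar>f t - a\<bar> + \<bar>g t - b\<bar>)"
        using L_lipschitz[of "f t" "g t" a b] L_lipschitz[of a b "f t" "g t"]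
        by (simp add: abs_le_iff abs_minus_commute)
    qed
  qed
qed

text \<open>
The density of the extreme value copula at \<open>(u, v)\<close> with \<open>a = - ln u\<close>, \<open>b = - ln v\<close>, and equally
that of the inverted copula at \<open>(1 - u, 1 - v)\<close>.
\<close>
definition dens :: "real \<Rightarrow> real \<Rightarrow> real" where
  "dens a b = exp (a + b - L a b) * (La a b * Lb a b + D a b)"

lemma dens_pos: "0 < a \<Longrightarrow> 0 < b \<Longrightarrow> 0 < dens a b"
  unfolding dens_def using La_pos Lb_pos D_pos by (intro mult_pos_pos add_pos_pos) auto

lemma survival_deriv:
  assumes ab: "0 < a" "0 < b"
  shows "((\<lambda>x. exp (- L x b) * Lb x b) has_real_derivative - (exp (- L a b) * (La a b * Lb a b + D a b))) (at a)"
  by (rule derivative_eq_intros L_deriv1[OF ab] Lb_deriv1[OF ab] refl)+ (simp add: algebra_simps)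

text \<open>
Both terms contain the same product of powers of \<open>a / (a + b)\<close> and \<open>b / (a + b)\<close>; relative to
\<open>La * Lb\<close>, the term \<open>D\<close> carries an additional factor \<open>1 / (a + b)\<close>.
\<close>
lemma dens_comparable:
  assumes ab: "0 < a" "0 < b"
  shows "comparable (K * K) (dens a b)
    (exp (a + b - L a b) * ((a / (a + b)) powr (1 + s1) * (b / (a + b)) powr (1 + s2) * (1 + 1 / (a + b))))"
proof -
  let ?R = "(a / (a + b)) powr (1 + s1) * (b / (a + b)) powr (1 + s2)"
  have K1: "0 < K" "K \<le> K * K" using K by (auto simp: mult_le_cancel_right1 mult_le_cancel_left1)
  have "comparable (K * K) (La a b * Lb a b) ?R"
    by (rule comparable_mult[OF La_bound[OF ab] Lb_bound[OF ab]]) (use K in auto)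
  moreover have "comparable (K * K) (D a b) (?R * (1 / (a + b)))"
  proof -
    have "comparable K (1 / (a + b) * ((a + b) * D a b)) (1 / (a + b) * ?R)"
      using ab by (intro comparable_cmult D_bound) auto
    then have "comparable K (D a b) (?R * (1 / (a + b)))" using ab by simp
    then show ?thesis by (rule comparable_mono) (use K1 ab in auto)
  qed
  ultimately have "comparable (K * K) (La a b * Lb a b + D a b) (?R + ?R * (1 / (a + b)))"
    by (rule comparable_add)
  then show ?thesis unfolding dens_def by (intro comparable_cmult) (auto simp: distrib_left)
qed

lemma ratio_rate:
  assumes "has_rate a (- \<alpha>)" "has_rate b (- \<beta>)"
  shows "has_rate (\<lambda>t. a t / (a t + b t)) (- (\<alpha> - min \<alpha> \<beta>))"
    "has_rate (\<lambda>t. b t / (a t + b t)) (- (\<beta> - min \<alpha> \<beta>))"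
    "has_rate (\<lambda>t. a t + b t) (- min \<alpha> \<beta>)"
proof -
  have "has_rate (\<lambda>t. a t + b t) (max (- \<alpha>) (- \<beta>))" by (rule has_rate_add[OF assms])
  moreover have "max (- \<alpha>) (- \<beta>) = - min \<alpha> \<beta>" by auto
  ultimately show *: "has_rate (\<lambda>t. a t + b t) (- min \<alpha> \<beta>)" by simp
  show "has_rate (\<lambda>t. a t / (a t + b t)) (- (\<alpha> - min \<alpha> \<beta>))"
    using has_rate_divide[OF assms(1) *] by (simp add: algebra_simps)
  show "has_rate (\<lambda>t. b t / (a t + b t)) (- (\<beta> - min \<alpha> \<beta>))"
    using has_rate_divide[OF assms(2) *] by (simp add: algebra_simps)
qed

text \<open>
Levels may tend to 0 exponentially or grow linearly. In the exponential factor only the linear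
growth counts and enters through homogeneity and continuity of \<open>L\<close>; in the power factors
only the exponential decay counts. As the rates of the levels are not positive, \<open>1 + 1 / (a + b)\<close>
has the rate of \<open>1 / (a + b)\<close>.
\<close>
lemma dens_rate:
  assumes a: "has_rate a (- \<alpha>)" and b: "has_rate b (- \<beta>)" and nn: "0 \<le> \<alpha>" "0 \<le> \<beta>"
    and p: "((\<lambda>t. a t / t) \<longlongrightarrow> p) at_top" and q: "((\<lambda>t. b t / t) \<longlongrightarrow> q) at_top"
  shows "has_rate (\<lambda>t. dens (a t) (b t)) (p + q - L p q - pair_gauge s1 s2 \<alpha> \<beta>)"
  unfolding pair_gauge_def
proof (rule has_rate_comparable)
  have e: "\<forall>\<^sub>F t in at_top. 0 < a t \<and> 0 < b t"
    using a b by (auto simp: has_rate_def eventually_conj_iff)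
  have "((\<lambda>t. a t / t + b t / t - L (a t / t) (b t / t)) \<longlongrightarrow> p + q - L p q) at_top"
    by (intro tendsto_intros tendsto_L p q)
  then have "((\<lambda>t. (a t + b t - L (a t) (b t)) / t) \<longlongrightarrow> p + q - L p q) at_top"
  proof (rule Lim_transform_eventually)
    show "\<forall>\<^sub>F t in at_top. a t / t + b t / t - L (a t / t) (b t / t) = (a t + b t - L (a t) (b t)) / t"
      using eventually_gt_at_top[of 0]
    proof eventually_elim
      case (elim t)
      have "L (inverse t * a t) (inverse t * b t) = inverse t * L (a t) (b t)"
        using elim by (intro L_homogeneous) auto
      then show ?case by (simp add: divide_inverse algebra_simps)
    qed
  qed
  then have 1: "has_rate (\<lambda>t. exp (a t + b t - L (a t) (b t))) (p + q - L p q)" by (rule has_rate_exp)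
  have "has_rate (\<lambda>t. 1 / (a t + b t)) (min \<alpha> \<beta>)"
    using has_rate_inverse[OF ratio_rate(3)[OF a b]] by (simp add: divide_inverse)
  from has_rate_add[OF has_rate_const[of 1] this]
  have 2: "has_rate (\<lambda>t. 1 + 1 / (a t + b t)) (min \<alpha> \<beta>)" using nn by simp
  have "has_rate (\<lambda>t. exp (a t + b t - L (a t) (b t)) * ((a t / (a t + b t)) powr (1 + s1) *
      (b t / (a t + b t)) powr (1 + s2) * (1 + 1 / (a t + b t))))
     ((p + q - L p q) + ((1 + s1) * - (\<alpha> - min \<alpha> \<beta>) + (1 + s2) * - (\<beta> - min \<alpha> \<beta>) + min \<alpha> \<beta>))"
    by (intro has_rate_mult has_rate_powr 1 2 ratio_rate[OF a b])
  then show "has_rate (\<lambda>t. exp (a t + b t - L (a t) (b t)) * ((a t / (a t + b t)) powr (1 + s1) *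
      (b t / (a t + b t)) powr (1 + s2) * (1 + 1 / (a t + b t))))
     (p + q - L p q - ((1 + s1) * (\<alpha> - min \<alpha> \<beta>) + (1 + s2) * (\<beta> - min \<alpha> \<beta>) - min \<alpha> \<beta>))"
    by (simp add: algebra_simps)
  show "\<forall>\<^sub>F t in at_top. comparable (K * K) (dens (a t) (b t)) (exp (a t + b t - L (a t) (b t)) *
      ((a t / (a t + b t)) powr (1 + s1) * (b t / (a t + b t)) powr (1 + s2) * (1 + 1 / (a t + b t))))"
    using e by eventually_elim (rule dens_comparable; simp)
  show "0 < K * K" using K by simp
qed

text \<open>
The conditional distribution function of the first variable given the second, the derivative of the
extreme value copula in its second argument, at exponential margins.
\<close>
definition cond_cdf :: "real \<Rightarrow> real \<Rightarrow> real" where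
  "cond_cdf x y = exp (exp_level y - L (exp_level x) (exp_level y)) * Lb (exp_level x) (exp_level y)"

lemma cond_cdf_pos: "0 < x \<Longrightarrow> 0 < y \<Longrightarrow> 0 < cond_cdf x y"
  unfolding cond_cdf_def by (simp add: Lb_pos exp_level_pos)

text \<open>
The exponent satisfies \<open>0 \<le> L - b \<le> a * La \<le> a\<close> by Euler's relation, so the exponential factor of the
conditional distribution function is harmless.
\<close>
lemma cond_survival_bounds:
  assumes "0 < x" "0 < y"
  defines "a \<equiv> exp_level x" and "b \<equiv> exp_level y"
  shows "1 - Lb a b \<le> 1 - cond_cdf x y"
    and "1 - cond_cdf x y \<le> (1 - Lb a b) + a * La a b"
    and "exp (- a) * Lb a b \<le> cond_cdf x y" "cond_cdf x y \<le> Lb a b"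
proof -
  have ab: "0 < a" "0 < b" using assms exp_level_pos by auto
  note l = Lb_pos[OF ab] Lb_lt_1[OF ab] La_pos[OF ab]
  have c: "cond_cdf x y = exp (b - L a b) * Lb a b" unfolding cond_cdf_def a_def b_def ..
  have e: "exp (b - L a b) \<le> 1" using L_ge(2)[of b a] by simp
  then show 1: "cond_cdf x y \<le> Lb a b" unfolding c using l by simp
  then show "1 - Lb a b \<le> 1 - cond_cdf x y" by simp
  have "- a \<le> b - L a b" using L_le[of a b] ab by simp
  then show "exp (- a) * Lb a b \<le> cond_cdf x y" unfolding c using l by simp
  have z: "L a b - b \<le> a * La a b" "0 \<le> L a b - b"
    using euler[OF ab] l ab L_ge(2)[of b a] mult_left_mono[of "Lb a b" 1 b] by auto
  have "1 + (b - L a b) \<le> exp (b - L a b)" by (rule exp_ge_add_one_self)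
  then have "(1 - (L a b - b)) * Lb a b \<le> exp (b - L a b) * Lb a b" using l(1) by (intro mult_right_mono) linarith+
  moreover have "(L a b - b) * Lb a b \<le> (L a b - b) * 1" using z l by (intro mult_left_mono) auto
  ultimately show "1 - cond_cdf x y \<le> (1 - Lb a b) + a * La a b"
    unfolding c using z by (simp add: algebra_simps)
qed

lemma cond_cdf_lt_1: "0 < x \<Longrightarrow> 0 < y \<Longrightarrow> cond_cdf x y < 1"
  using cond_survival_bounds(1)[of x y] Lb_lt_1[of "exp_level x" "exp_level y"] exp_level_pos by fastforce

lemma cond_survival_comparison:
  assumes "0 < x" "0 < y"
  defines "a \<equiv> exp_level x" and "b \<equiv> exp_level y"
  shows "1 / K * (a / (a + b)) powr (2 + s1) \<le> 1 - cond_cdf x y"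
    and "1 - cond_cdf x y \<le> K * (a / (a + b)) powr (2 + s1) + K * a * (a / (a + b)) powr (1 + s1)"
proof -
  have ab: "0 < a" "0 < b" using assms exp_level_pos by auto
  have "1 / K * (a / (a + b)) powr (2 + s1) \<le> 1 - Lb a b" "1 - Lb a b \<le> K * (a / (a + b)) powr (2 + s1)"
    using Lb_bound'[OF ab] unfolding comparable_def by auto
  moreover have "La a b \<le> K * (a / (a + b)) powr (1 + s1)"
    using La_bound[OF ab] unfolding comparable_def by auto
  then have "a * La a b \<le> K * a * (a / (a + b)) powr (1 + s1)"
    using mult_left_mono[of "La a b" _ a] ab by (simp add: mult_ac)
  ultimately show "1 / K * (a / (a + b)) powr (2 + s1) \<le> 1 - cond_cdf x y"
    "1 - cond_cdf x y \<le> K * (a / (a + b)) powr (2 + s1) + K * a * (a / (a + b)) powr (1 + s1)"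
    using cond_survival_bounds(1,2)[OF assms(1,2)] unfolding a_def b_def by linarith+
qed

lemma cond_cdf_rate:
  assumes x: "0 < x" "0 < y"
  shows "has_rate (\<lambda>t. cond_cdf (t * x) (t * y)) (- ((1 + s2) * (y - min x y)))"
    and "has_rate (\<lambda>t. 1 - cond_cdf (t * x) (t * y)) (- ((2 + s1) * (x - min x y)))"
proof -
  define a b where "a = (\<lambda>t. exp_level (t * x))" and "b = (\<lambda>t. exp_level (t * y))"
  have a: "has_rate a (- x)" and b: "has_rate b (- y)"
    unfolding a_def b_def using exp_level_rate x by auto
  have pos: "\<forall>\<^sub>F t in at_top. 0 < t * x \<and> 0 < t * y"
    using eventually_gt_at_top[of 0] by eventually_elim (use x in auto)
  have ab: "\<forall>\<^sub>F t in at_top. 0 < a t \<and> 0 < b t"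
    using pos unfolding a_def b_def by eventually_elim (simp add: exp_level_pos)
  have "filterlim (\<lambda>t. t * x) at_top at_top"
    using x by (intro filterlim_at_top_mult_tendsto_pos[OF tendsto_const]) (auto simp: filterlim_ident)
  then have a0: "(a \<longlongrightarrow> 0) at_top"
    unfolding a_def by (rule filterlim_compose[OF exp_level_tendsto])
  have "has_rate (\<lambda>t. (b t / (a t + b t)) powr (1 + s2)) ((1 + s2) * - (y - min x y))"
    by (intro has_rate_powr ratio_rate[OF a b])
  then have "has_rate (\<lambda>t. (b t / (a t + b t)) powr (1 + s2)) (- ((1 + s2) * (y - min x y)))"
    by (simp add: algebra_simps)
  then have Lb: "has_rate (\<lambda>t. Lb (a t) (b t)) (- ((1 + s2) * (y - min x y)))"
  proof (rule has_rate_comparable[where K=K])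
    show "\<forall>\<^sub>F t in at_top. comparable K (Lb (a t) (b t)) ((b t / (a t + b t)) powr (1 + s2))"
      using ab by eventually_elim (simp add: Lb_bound)
  qed (use K in simp)
  show "has_rate (\<lambda>t. cond_cdf (t * x) (t * y)) (- ((1 + s2) * (y - min x y)))"
  proof (rule has_rate_squeeze[OF _ Lb])
    have "((\<lambda>t. - a t / t) \<longlongrightarrow> 0) at_top"
      by (intro tendsto_divide_0[where c="- 0"] tendsto_minus a0 filterlim_at_top_imp_at_infinity filterlim_ident)
    from has_rate_mult[OF has_rate_exp[OF this] Lb]
    show "has_rate (\<lambda>t. exp (- a t) * Lb (a t) (b t)) (- ((1 + s2) * (y - min x y)))" by simp
    show "\<forall>\<^sub>F t in at_top. exp (- a t) * Lb (a t) (b t) \<le> cond_cdf (t * x) (t * y)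
        \<and> cond_cdf (t * x) (t * y) \<le> Lb (a t) (b t)"
      using pos unfolding a_def b_def by eventually_elim (simp add: cond_survival_bounds(3,4))
  qed
  have "has_rate (\<lambda>t. (a t / (a t + b t)) powr (2 + s1)) ((2 + s1) * - (x - min x y))"
    by (intro has_rate_powr ratio_rate[OF a b])
  then have r1: "has_rate (\<lambda>t. (a t / (a t + b t)) powr (2 + s1)) (- ((2 + s1) * (x - min x y)))"
    by (simp only: mult_minus_right)
  have r2: "has_rate (\<lambda>t. 1 + (a t + b t)) (max 0 (- min x y))"
    by (intro has_rate_add has_rate_const ratio_rate[OF a b]) simp
  show "has_rate (\<lambda>t. 1 - cond_cdf (t * x) (t * y)) (- ((2 + s1) * (x - min x y)))"
  proof (rule has_rate_squeeze)
    show "has_rate (\<lambda>t. 1 / K * (a t / (a t + b t)) powr (2 + s1)) (- ((2 + s1) * (x - min x y)))"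
      using has_rate_cmult[OF r1, of "1 / K"] K by simp
    show "has_rate (\<lambda>t. K * (a t / (a t + b t)) powr (2 + s1) * (1 + (a t + b t))) (- ((2 + s1) * (x - min x y)))"
      using has_rate_mult[OF has_rate_cmult[OF r1, of K] r2] K x by simp
    show "\<forall>\<^sub>F t in at_top. 1 / K * (a t / (a t + b t)) powr (2 + s1) \<le> 1 - cond_cdf (t * x) (t * y) \<and>
        1 - cond_cdf (t * x) (t * y) \<le> K * (a t / (a t + b t)) powr (2 + s1) * (1 + (a t + b t))"
      using pos ab
    proof eventually_elim
      case (elim t)
      have "(a t / (a t + b t)) powr (2 + s1) = (a t / (a t + b t)) powr (1 + (1 + s1))" by simp
      also have "\<dots> = a t / (a t + b t) * (a t / (a t + b t)) powr (1 + s1)"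
        using elim by (subst powr_add) auto
      finally have "K * a t * (a t / (a t + b t)) powr (1 + s1) = K * (a t / (a t + b t)) powr (2 + s1) * (a t + b t)"
        using elim by simp
      then show ?case using cond_survival_comparison[of "t * x" "t * y"] elim
        unfolding a_def b_def by (auto simp: distrib_left)
    qed
  qed
qed

text \<open>
The argument at which the stable tail dependence function of the inverted conditional copula is evaluated.
\<close>
definition cond_level :: "real \<Rightarrow> real \<Rightarrow> real" where
  "cond_level x y = - ln (1 - cond_cdf x y)"

lemma cond_level_pos: "0 < x \<Longrightarrow> 0 < y \<Longrightarrow> 0 < cond_level x y"
  unfolding cond_level_def using cond_cdf_pos[of x y] cond_cdf_lt_1[of x y] by simp

text \<open>
One of \<open>x - min x y\<close> and \<open>y - min x y\<close> vanishes, hence one of the conditional distribution function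
and its complement has rate 0.
\<close>
lemma cond_level_rate:
  assumes x: "0 < x" "0 < y"
  shows "has_rate (\<lambda>t. cond_level (t * x) (t * y)) (- ((1 + s2) * (y - min x y)))"
    and "((\<lambda>t. cond_level (t * x) (t * y) / t) \<longlongrightarrow> (2 + s1) * (x - min x y)) at_top"
  unfolding cond_level_def
  by (rule has_rate_neg_ln[OF cond_cdf_rate[OF x]]; use s1 in \<open>auto simp: min_def\<close>)+

end

section \<open>Extreme value copulas and inverted extreme value copulas\<close>

context stdf
begin

definition V :: "real \<Rightarrow> real \<Rightarrow> real" where
  "V x y = L (inverse x) (inverse y)"

lemma ev_copula_eq: "ev_copula V u v = exp (- L (- ln u) (- ln v))"
  by (simp add: ev_copula_def V_def)

lemma inverted_ev_copula_eq:
  "inverted_ev_copula V u v = u + v - 1 + exp (- L (- ln (1 - u)) (- ln (1 - v)))"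
  by (simp add: inverted_ev_copula_def V_def)

lemma ev_copula_deriv2:
  assumes u: "0 < u" "u < 1" and v: "0 < v" "v < 1"
  shows "((\<lambda>v. ev_copula V u v) has_real_derivative
    exp (- L (- ln u) (- ln v)) * Lb (- ln u) (- ln v) / v) (at v)"
proof -
  have pos: "0 < - ln u" "0 < - ln v" using u v by auto
  have "((\<lambda>v. - ln v) has_real_derivative - (1 / v)) (at v)"
    using v by (auto intro!: derivative_eq_intros)
  from DERIV_chain2[OF L_deriv2[OF pos] this]
  have "((\<lambda>v. L (- ln u) (- ln v)) has_real_derivative Lb (- ln u) (- ln v) * - (1 / v)) (at v)" .
  then show ?thesis unfolding ev_copula_eq by (auto intro!: derivative_eq_intros)
qed

lemma exp_uminus_ln: "0 < u \<Longrightarrow> exp (- ln u) = 1 / u" for u :: real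
  by (simp add: exp_minus inverse_eq_divide)

text \<open>
The mixed derivative of \<open>exp (- L)\<close> is \<open>exp (- L) * (La * Lb + D)\<close>, and passing to \<open>u\<close> and \<open>v\<close> multiplies it
by \<open>1 / (u * v) = exp (a + b)\<close>.
\<close>
lemma copula_density_ev:
  assumes u: "0 < u" "u < 1" and v: "0 < v" "v < 1"
  shows "copula_density (ev_copula V) u v = dens (- ln u) (- ln v)"
proof -
  have pos: "0 < - ln u" "0 < - ln v" using u v by auto
  have "((\<lambda>u. - ln u) has_real_derivative - (1 / u)) (at u)"
    using u by (auto intro!: derivative_eq_intros)
  from DERIV_cdivide[OF DERIV_chain2[OF survival_deriv[OF pos] this], of v]
  have "((\<lambda>u. exp (- L (- ln u) (- ln v)) * Lb (- ln u) (- ln v) / v) has_real_derivative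
      - (exp (- L (- ln u) (- ln v)) * (La (- ln u) (- ln v) * Lb (- ln u) (- ln v) + D (- ln u) (- ln v)))
        * - (1 / u) / v) (at u)" .
  moreover have "- (exp (- L (- ln u) (- ln v)) * (La (- ln u) (- ln v) * Lb (- ln u) (- ln v) + D (- ln u) (- ln v)))
        * - (1 / u) / v = dens (- ln u) (- ln v)"
    unfolding dens_def using u v by (simp add: exp_add exp_diff exp_uminus_ln exp_minus divide_inverse)
  ultimately have *: "((\<lambda>u. exp (- L (- ln u) (- ln v)) * Lb (- ln u) (- ln v) / v) has_real_derivative
      dens (- ln u) (- ln v)) (at u)" by simp
  have "((\<lambda>u'. deriv (\<lambda>v'. ev_copula V u' v') v) has_real_derivative dens (- ln u) (- ln v)) (at u)"
    by (rule has_field_derivative_transform_within_open[OF *, where S="{0<..<1}"])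
       (use u v in \<open>auto intro!: DERIV_imp_deriv[symmetric] ev_copula_deriv2\<close>)
  then show ?thesis unfolding copula_density_def by (rule DERIV_imp_deriv)
qed

lemma inverted_ev_copula_deriv2:
  assumes u: "0 < u" "u < 1" and v: "0 < v" "v < 1"
  shows "((\<lambda>v. inverted_ev_copula V u v) has_real_derivative
    1 - exp (- L (- ln (1 - u)) (- ln (1 - v))) * Lb (- ln (1 - u)) (- ln (1 - v)) / (1 - v)) (at v)"
proof -
  have pos: "0 < - ln (1 - u)" "0 < - ln (1 - v)" using u v by auto
  have "((\<lambda>v. - ln (1 - v)) has_real_derivative 1 / (1 - v)) (at v)"
    using v by (auto intro!: derivative_eq_intros)
  from DERIV_chain2[OF L_deriv2[OF pos] this]
  have "((\<lambda>v. L (- ln (1 - u)) (- ln (1 - v))) has_real_derivative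
      Lb (- ln (1 - u)) (- ln (1 - v)) * (1 / (1 - v))) (at v)" .
  then show ?thesis unfolding inverted_ev_copula_eq by (auto intro!: derivative_eq_intros)
qed

text \<open>
The mixed derivative annihilates the terms that are linear in \<open>u\<close> and \<open>v\<close>, and the two signs from
\<open>1 - u\<close> and \<open>1 - v\<close> cancel.
\<close>
lemma copula_density_inverted_ev:
  assumes u: "0 < u" "u < 1" and v: "0 < v" "v < 1"
  shows "copula_density (inverted_ev_copula V) u v = dens (- ln (1 - u)) (- ln (1 - v))"
proof -
  have pos: "0 < - ln (1 - u)" "0 < - ln (1 - v)" using u v by auto
  let ?a = "- ln (1 - u)" and ?b = "- ln (1 - v)"
  have "((\<lambda>u. - ln (1 - u)) has_real_derivative 1 / (1 - u)) (at u)"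
    using u by (auto intro!: derivative_eq_intros)
  from DERIV_diff[OF DERIV_const[of 1] DERIV_cdivide[OF DERIV_chain2[OF survival_deriv[OF pos] this], of "1 - v"]]
  have "((\<lambda>u. 1 - exp (- L (- ln (1 - u)) ?b) * Lb (- ln (1 - u)) ?b / (1 - v)) has_real_derivative
      0 - - (exp (- L ?a ?b) * (La ?a ?b * Lb ?a ?b + D ?a ?b)) * (1 / (1 - u)) / (1 - v)) (at u)" .
  moreover have "0 - - (exp (- L ?a ?b) * (La ?a ?b * Lb ?a ?b + D ?a ?b)) * (1 / (1 - u)) / (1 - v) = dens ?a ?b"
    unfolding dens_def using u v by (simp add: exp_add exp_diff exp_uminus_ln exp_minus divide_inverse)
  ultimately have *: "((\<lambda>u. 1 - exp (- L (- ln (1 - u)) ?b) * Lb (- ln (1 - u)) ?b / (1 - v)) has_real_derivative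
      dens ?a ?b) (at u)" by simp
  have "((\<lambda>u'. deriv (\<lambda>v'. inverted_ev_copula V u' v') v) has_real_derivative dens ?a ?b) (at u)"
    by (rule has_field_derivative_transform_within_open[OF *, where S="{0<..<1}"])
       (use u v in \<open>auto intro!: DERIV_imp_deriv[symmetric] inverted_ev_copula_deriv2\<close>)
  then show ?thesis unfolding copula_density_def by (rule DERIV_imp_deriv)
qed

lemma cond_cdf_eq_deriv:
  assumes "0 < x" "0 < y"
  shows "deriv (\<lambda>v. ev_copula V (exp_cdf x) v) (exp_cdf y) = cond_cdf x y"
proof -
  note u = exp_cdf_in_unit(1)[OF assms(1)] exp_cdf_in_unit(2)[of x]
  note v = exp_cdf_in_unit(1)[OF assms(2)] exp_cdf_in_unit(2)[of y]
  have "deriv (\<lambda>v. ev_copula V (exp_cdf x) v) (exp_cdf y) =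
      exp (- L (exp_level x) (exp_level y)) * Lb (exp_level x) (exp_level y) / exp_cdf y"
    using DERIV_imp_deriv[OF ev_copula_deriv2[OF u v]] by (simp add: exp_level_def)
  also have "\<dots> = cond_cdf x y"
    unfolding cond_cdf_def using v
    by (simp add: exp_level_def[of y] exp_diff exp_uminus_ln exp_minus divide_inverse)
  finally show ?thesis .
qed

lemma continuous_on_L:
  assumes "continuous_on S f" "continuous_on S g"
  shows "continuous_on S (\<lambda>x. L (f x) (g x))"
  using assms unfolding continuous_on_def by (auto intro: tendsto_L)

lemma L_axis: "0 \<le> p \<Longrightarrow> L p 0 = p" "0 \<le> q \<Longrightarrow> L 0 q = q"
  using L_ge(1)[of p 0] L_le[of p 0] L_ge(2)[of q 0] L_le[of 0 q] by auto

lemma L_nonneg: "0 \<le> p \<Longrightarrow> 0 \<le> L p q"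
  using L_ge(1)[of p q] by linarith

end

section \<open>The gauge function of the vine\<close>

text \<open>
Three stable tail dependence functions, for the pairs 12 and 23 and for the conditional pair 13|2. The
sublocale \<open>P32\<close> is the pair 23 with its arguments exchanged, as both conditionings are on the
middle variable.
\<close>
locale vine =
  P12: stdf L12 La12 Lb12 D12 s1_12 s2_12 K12 +
  P23: stdf L23 La23 Lb23 D23 s1_23 s2_23 K23 +
  P132: stdf L132 La132 Lb132 D132 s1_132 s2_132 K132
  for L12 La12 Lb12 D12 s1_12 s2_12 K12
    and L23 La23 Lb23 D23 s1_23 s2_23 K23
    and L132 La132 Lb132 D132 s1_132 s2_132 K132
begin

sublocale P32: stdf "\<lambda>a b. L23 b a" "\<lambda>a b. Lb23 b a" "\<lambda>a b. La23 b a" "\<lambda>a b. D23 b a" s2_23 s1_23 K23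
  by (rule stdf_flip) unfold_locales

lemma P32_dens: "P32.dens a b = P23.dens b a"
  unfolding P32.dens_def P23.dens_def by (simp add: mult.commute add.commute)

lemma P32_cond_cdf:
  assumes "0 < x" "0 < y"
  shows "deriv (\<lambda>u. ev_copula P23.V u (exp_cdf x)) (exp_cdf y) = P32.cond_cdf x y"
proof -
  have "(\<lambda>u. ev_copula P23.V u (exp_cdf x)) = (\<lambda>v. ev_copula P32.V (exp_cdf x) v)"
    unfolding P23.ev_copula_eq P32.ev_copula_eq ..
  then show ?thesis using P32.cond_cdf_eq_deriv[OF assms] by simp
qed

definition f :: "real \<times> real \<times> real \<Rightarrow> real" where
  "f = vine_density (ev_copula P12.V) (ev_copula P23.V) (inverted_ev_copula P132.V)"

lemma f_eq:
  assumes x: "0 < x1" "0 < x2" "0 < x3"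
  shows "f (x1, x2, x3) = exp (- x1) * exp (- x2) * exp (- x3)
    * P12.dens (exp_level x1) (exp_level x2) * P23.dens (exp_level x2) (exp_level x3)
    * P132.dens (P12.cond_level x1 x2) (P32.cond_level x3 x2)"
  using x unfolding f_def vine_density_def Let_def
  by (simp add: P12.cond_cdf_eq_deriv P32_cond_cdf P12.copula_density_ev P23.copula_density_ev
      P132.copula_density_inverted_ev exp_cdf_in_unit P12.cond_cdf_pos P12.cond_cdf_lt_1
      P32.cond_cdf_pos P32.cond_cdf_lt_1 exp_level_def P12.cond_level_def P32.cond_level_def)

lemma f_eq_0: "\<not> (0 < x1 \<and> 0 < x2 \<and> 0 < x3) \<Longrightarrow> f (x1, x2, x3) = 0"
  unfolding f_def vine_density_def by auto

text \<open>
The sum of the rates of the six factors of the density, with the sign reversed. The arguments of the third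
\<open>pair_gauge\<close> are the decay rates of the two conditional levels, and \<open>p\<close> and \<open>q\<close> are their linear
growth rates.
\<close>
definition gauge :: "real \<times> real \<times> real \<Rightarrow> real" where
  "gauge = (\<lambda>(x1, x2, x3).
    (let p = (2 + s1_12) * (x1 - min x1 x2); q = (2 + s2_23) * (x3 - min x3 x2) in
     x1 + x2 + x3 + pair_gauge s1_12 s2_12 x1 x2 + pair_gauge s1_23 s2_23 x2 x3
     + pair_gauge s1_132 s2_132 ((1 + s2_12) * (x2 - min x1 x2)) ((1 + s1_23) * (x2 - min x3 x2))
     + (L132 p q - p - q)))"

lemma f_rate:
  assumes x: "0 < x1" "0 < x2" "0 < x3"
  shows "has_rate (\<lambda>t. f (t * x1, t * x2, t * x3)) (- gauge (x1, x2, x3))"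
proof -
  have lin: "has_rate (\<lambda>t. exp (- (t * x))) (- x)" for x
    by (rule has_rate_exp, rule Lim_transform_eventually[OF tendsto_const])
       (use eventually_gt_at_top[of "0::real"] in eventually_elim, auto)
  have lvl0: "((\<lambda>t. exp_level (t * x) / t) \<longlongrightarrow> 0) at_top" if "0 < x" for x
  proof -
    have "filterlim (\<lambda>t. t * x) at_top at_top"
      using that by (intro filterlim_at_top_mult_tendsto_pos[OF tendsto_const]) (auto simp: filterlim_ident)
    then have "((\<lambda>t. exp_level (t * x)) \<longlongrightarrow> 0) at_top"
      by (rule filterlim_compose[OF exp_level_tendsto])
    then show ?thesis by (rule tendsto_divide_0[OF _ filterlim_at_top_imp_at_infinity[OF filterlim_ident]])
  qed
  have d12: "has_rate (\<lambda>t. P12.dens (exp_level (t * x1)) (exp_level (t * x2)))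
      (0 + 0 - L12 0 0 - pair_gauge s1_12 s2_12 x1 x2)"
    using x by (intro P12.dens_rate exp_level_rate lvl0) auto
  have d23: "has_rate (\<lambda>t. P23.dens (exp_level (t * x2)) (exp_level (t * x3)))
      (0 + 0 - L23 0 0 - pair_gauge s1_23 s2_23 x2 x3)"
    using x by (intro P23.dens_rate exp_level_rate lvl0) auto
  have nn: "0 \<le> (1 + s2_12) * (x2 - min x1 x2)" "0 \<le> (1 + s1_23) * (x2 - min x3 x2)"
    using P12.s2 P23.s1 by auto
  note d132 = P132.dens_rate[OF P12.cond_level_rate(1)[OF x(1,2)] P32.cond_level_rate(1)[OF x(3,2)] nn
      P12.cond_level_rate(2)[OF x(1,2)] P32.cond_level_rate(2)[OF x(3,2)]]
  note all = has_rate_mult[OF has_rate_mult[OF has_rate_mult[OF has_rate_mult[OF has_rate_mult[OF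
      lin[of x1] lin[of x2]] lin[of x3]] d12] d23] d132]
  have "has_rate (\<lambda>t. exp (- (t * x1)) * exp (- (t * x2)) * exp (- (t * x3)) *
      P12.dens (exp_level (t * x1)) (exp_level (t * x2)) *
      P23.dens (exp_level (t * x2)) (exp_level (t * x3)) *
      P132.dens (P12.cond_level (t * x1) (t * x2)) (P32.cond_level (t * x3) (t * x2))) (- gauge (x1, x2, x3))"
    using all by (simp add: gauge_def Let_def P12.L_0_0 P23.L_0_0 algebra_simps)
  moreover have "(1::real) > 0" by simp
  moreover have "\<forall>\<^sub>F t in at_top. comparable 1 (f (t * x1, t * x2, t * x3))
     (exp (- (t * x1)) * exp (- (t * x2)) * exp (- (t * x3)) *
      P12.dens (exp_level (t * x1)) (exp_level (t * x2)) *
      P23.dens (exp_level (t * x2)) (exp_level (t * x3)) *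
      P132.dens (P12.cond_level (t * x1) (t * x2)) (P32.cond_level (t * x3) (t * x2)))"
    using eventually_gt_at_top[of 0]
    by eventually_elim (use x in \<open>simp add: f_eq comparable_def\<close>)
  ultimately show ?thesis by (rule has_rate_comparable)
qed

lemma gauge_cases:
  assumes nn: "0 \<le> x1" "0 \<le> x2" "0 \<le> x3"
  defines "\<alpha> \<equiv> (1 + s2_12) * (x2 - x1)" and "\<beta> \<equiv> (1 + s1_23) * (x2 - x3)"
  shows "max x1 x3 < x2 \<Longrightarrow> gauge (x1, x2, x3) =
      x2 + (2 + (if \<alpha> \<ge> \<beta> then s1_132 else s2_132)) * max \<alpha> \<beta> - (1 + (if \<alpha> \<ge> \<beta> then s1_132 else s2_132)) * min \<alpha> \<beta>"
    and "x1 < x2 \<Longrightarrow> x2 \<le> x3 \<Longrightarrow> gauge (x1, x2, x3) =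
      x2 + (2 + s1_132) * (1 + s2_12) * (x2 - x1) + (2 + s2_23) * (x3 - x2)"
    and "x3 < x2 \<Longrightarrow> x2 \<le> x1 \<Longrightarrow> gauge (x1, x2, x3) =
      x2 + (2 + s2_132) * (1 + s1_23) * (x2 - x3) + (2 + s1_12) * (x1 - x2)"
    and "x2 \<le> min x1 x3 \<Longrightarrow> gauge (x1, x2, x3) = x2 + L132 ((2 + s1_12) * (x1 - x2)) ((2 + s2_23) * (x3 - x2))"
proof -
  note s = P12.s1 P12.s2 P23.s1 P23.s2
  show "gauge (x1, x2, x3) = x2 + (2 + (if \<alpha> \<ge> \<beta> then s1_132 else s2_132)) * max \<alpha> \<beta>
      - (1 + (if \<alpha> \<ge> \<beta> then s1_132 else s2_132)) * min \<alpha> \<beta>" if "max x1 x3 < x2"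
  proof -
    have "gauge (x1, x2, x3) = x2 + \<alpha> + \<beta> + pair_gauge s1_132 s2_132 \<alpha> \<beta>"
      using that unfolding gauge_def Let_def \<alpha>_def \<beta>_def pair_gauge_def[of s1_12] pair_gauge_def[of s1_23]
      by (simp add: P132.L_0_0 min_absorb1 min_absorb2)
    then show ?thesis unfolding pair_gauge_def by (cases "\<beta> \<le> \<alpha>") (auto simp: algebra_simps)
  qed
  show "gauge (x1, x2, x3) = x2 + (2 + s1_132) * (1 + s2_12) * (x2 - x1) + (2 + s2_23) * (x3 - x2)"
    if "x1 < x2" "x2 \<le> x3"
  proof -
    have "0 \<le> \<alpha>" "0 \<le> (2 + s2_23) * (x3 - x2)" using that s by (auto simp: \<alpha>_def)
    then have "gauge (x1, x2, x3) = x2 + (1 + s1_132) * \<alpha> + \<alpha> + (2 + s2_23) * (x3 - x2)"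
      using that unfolding gauge_def Let_def \<alpha>_def[symmetric] pair_gauge_def
      by (simp add: P132.L_axis min_absorb1 min_absorb2 flip: \<alpha>_def) (simp add: \<alpha>_def algebra_simps)
    then show ?thesis by (simp add: \<alpha>_def algebra_simps)
  qed
  show "gauge (x1, x2, x3) = x2 + (2 + s2_132) * (1 + s1_23) * (x2 - x3) + (2 + s1_12) * (x1 - x2)"
    if "x3 < x2" "x2 \<le> x1"
  proof -
    have "0 \<le> \<beta>" "0 \<le> (2 + s1_12) * (x1 - x2)" using that s by (auto simp: \<beta>_def)
    then have "gauge (x1, x2, x3) = x2 + (1 + s2_132) * \<beta> + \<beta> + (2 + s1_12) * (x1 - x2)"
      using that unfolding gauge_def Let_def \<beta>_def[symmetric] pair_gauge_def
      by (simp add: P132.L_axis min_absorb1 min_absorb2 flip: \<beta>_def) (simp add: \<beta>_def algebra_simps)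
    then show ?thesis by (simp add: \<beta>_def algebra_simps)
  qed
  show "gauge (x1, x2, x3) = x2 + L132 ((2 + s1_12) * (x1 - x2)) ((2 + s2_23) * (x3 - x2))"
    if "x2 \<le> min x1 x3"
    using that unfolding gauge_def Let_def pair_gauge_def
    by (simp add: min_absorb1 min_absorb2) (simp add: algebra_simps)
qed

text \<open>
The gauge function is positive on the open orthant. This is needed to pass from the limit of
\<open>- ln f / t\<close> to an asymptotic equivalence, which a vanishing limit would not give.
\<close>
lemma gauge_ge:
  assumes nn: "0 \<le> x1" "0 \<le> x2" "0 \<le> x3"
  shows "x2 \<le> gauge (x1, x2, x3)"
proof -
  note s = P12.s1 P12.s2 P23.s1 P23.s2 P132.s1 P132.s2
  have c1: "x2 \<le> x2 + (2 + s) * max a b - (1 + s) * min a b" if "-1 < s" "0 \<le> a" "0 \<le> b" for s a b :: real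
  proof -
    have "(1 + s) * min a b \<le> (1 + s) * max a b" using that by (intro mult_left_mono) auto
    moreover have "0 \<le> max a b" using that by auto
    ultimately show ?thesis by (simp add: algebra_simps)
  qed
  consider "max x1 x3 < x2" | "x1 < x2" "x2 \<le> x3" | "x3 < x2" "x2 \<le> x1" | "x2 \<le> min x1 x3"
    by (cases "x1 < x2"; cases "x3 < x2") (auto simp: not_less)
  then show ?thesis
  proof cases
    case 1
    then show ?thesis unfolding gauge_cases(1)[OF nn 1] using s by (intro c1) auto
  next
    case 2
    then have "0 \<le> (2 + s1_132) * (1 + s2_12) * (x2 - x1)" "0 \<le> (2 + s2_23) * (x3 - x2)"
      using s by (auto intro!: mult_nonneg_nonneg)
    then show ?thesis unfolding gauge_cases(2)[OF nn 2] by linarith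
  next
    case 3
    then have "0 \<le> (2 + s2_132) * (1 + s1_23) * (x2 - x3)" "0 \<le> (2 + s1_12) * (x1 - x2)"
      using s by (auto intro!: mult_nonneg_nonneg)
    then show ?thesis unfolding gauge_cases(3)[OF nn 3] by linarith
  next
    case 4
    then have "0 \<le> (2 + s1_12) * (x1 - x2)" using s by auto
    then show ?thesis unfolding gauge_cases(4)[OF nn 4] using P132.L_nonneg by simp
  qed
qed

lemma gauge_homogeneous:
  assumes r: "0 < r"
  shows "gauge (r * x1, r * x2, r * x3) = r * gauge (x1, x2, x3)"
proof -
  have m: "min (r * a) (r * b) = r * min a b" for a b using r by (simp add: min_mult_distrib_left)
  have lin: "c * (r * a - r * b) = r * (c * (a - b))" for a b c by (simp add: algebra_simps)
  have pg: "pair_gauge s s' (r * a) (r * b) = r * pair_gauge s s' a b" for s s' a b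
    unfolding pair_gauge_def m by (simp add: algebra_simps)
  show ?thesis unfolding gauge_def Let_def prod.case m lin pg P132.L_homogeneous[OF less_imp_le[OF r]]
    by (simp add: distrib_left right_diff_distrib)
qed

lemma gauge_continuous: "continuous_on S gauge"
proof -
  have "continuous_on S (\<lambda>x. gauge (fst x, fst (snd x), snd (snd x)))"
    unfolding gauge_def Let_def prod.case pair_gauge_def
    by (intro continuous_intros P132.continuous_on_L)
  then show ?thesis by simp
qed

lemma is_gauge_function_gauge: "is_gauge_function f gauge"
  unfolding is_gauge_function_def
proof (intro conjI ballI allI impI)
  show "gauge (r *\<^sub>R x) = r * gauge x" if "0 < r" for x and r :: real
    using gauge_homogeneous[OF that, of "fst x" "fst (snd x)" "snd (snd x)"]
    by (cases x) simp
  show "continuous_on nonneg_orthant gauge" by (rule gauge_continuous)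
  fix x assume "x \<in> pos_orthant"
  then obtain x1 x2 x3 where x: "x = (x1, x2, x3)" "0 < x1" "0 < x2" "0 < x3"
    unfolding pos_orthant_def by auto
  have g: "0 < gauge x" using gauge_ge[of x1 x2 x3] x by auto
  have "((\<lambda>t. ln (f (t *\<^sub>R x)) / t) \<longlongrightarrow> - gauge x) at_top"
    using f_rate[OF x(2-4)] unfolding has_rate_def x(1) by simp
  then have "((\<lambda>t. - (ln (f (t *\<^sub>R x)) / t) / gauge x) \<longlongrightarrow> - (- gauge x) / gauge x) at_top"
    using g by (intro tendsto_intros) auto
  then show "(\<lambda>t. - ln (f (t *\<^sub>R x))) \<sim>[at_top] (\<lambda>t. t * gauge x)"
    using g by (intro asymp_equivI') simp
qed

end

section \<open>Asymptotics of the conditional levels\<close>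

lemma exp_level_exp_tendsto: "((\<lambda>x. exp_level x * exp x) \<longlongrightarrow> 1) at_top"
proof (rule tendsto_sandwich)
  show "\<forall>\<^sub>F x in at_top. 1 \<le> exp_level x * exp x"
    using eventually_gt_at_top[of 0]
  proof eventually_elim
    case (elim x)
    have "exp (- x) * exp x \<le> exp_level x * exp x" using exp_level_lower[OF elim] by (intro mult_right_mono) auto
    then show ?case by (simp flip: exp_add)
  qed
  show "\<forall>\<^sub>F x in at_top. exp_level x * exp x \<le> inverse (1 - exp (- x))"
    using eventually_gt_at_top[of 0]
  proof eventually_elim
    case (elim x)
    note u = exp_cdf_in_unit(1)[OF elim]
    have "exp_level x = ln (inverse (exp_cdf x))" using u by (simp add: exp_level_def ln_inverse)
    also have "\<dots> \<le> inverse (exp_cdf x) - 1" using u by (intro ln_le_minus_one) auto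
    also have "\<dots> = exp (- x) * inverse (1 - exp (- x))" using u unfolding exp_cdf_def by (simp add: field_simps)
    finally have "exp_level x * exp x \<le> exp (- x) * inverse (1 - exp (- x)) * exp x" by (intro mult_right_mono) auto
    also have "\<dots> = inverse (1 - exp (- x))" by (simp add: exp_minus)
    finally show ?case .
  qed
  have "((\<lambda>x::real. exp (- x)) \<longlongrightarrow> 0) at_top"
    by (intro filterlim_compose[OF exp_at_bot] filterlim_uminus_at_bot_at_top)
  then have "((\<lambda>x::real. inverse (1 - exp (- x))) \<longlongrightarrow> inverse (1 - 0)) at_top"
    by (intro tendsto_intros) auto
  then show "((\<lambda>x::real. inverse (1 - exp (- x))) \<longlongrightarrow> 1) at_top" by simp
qed simp

lemma filterlim_shift_at_top: "filterlim (\<lambda>x::real. x + s) at_top at_top"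
  by (rule filterlim_tendsto_add_at_top[of "\<lambda>_. s", unfolded add.commute[of s]])
     (auto intro: filterlim_ident)

text \<open>
The level of a large \<open>x\<close> is asymptotically \<open>exp (- x)\<close>, so a shift acts on levels as multiplication.
\<close>
lemma exp_level_shift_ratio: "((\<lambda>x. exp_level x / exp_level (x + s)) \<longlongrightarrow> exp s) at_top"
proof -
  have "((\<lambda>x. exp_level (x + s) * exp (x + s)) \<longlongrightarrow> 1) at_top"
    by (rule filterlim_compose[OF exp_level_exp_tendsto filterlim_shift_at_top])
  then have "((\<lambda>x. exp s * (exp_level x * exp x) / (exp_level (x + s) * exp (x + s))) \<longlongrightarrow> exp s * 1 / 1) at_top"
    by (intro tendsto_intros exp_level_exp_tendsto) auto
  moreover have "exp s * (exp_level x * exp x) / (exp_level (x + s) * exp (x + s)) = exp_level x / exp_level (x + s)"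
    for x by (simp add: exp_add)
  ultimately show ?thesis by (simp only: mult_1_right div_by_1)
qed

context stdf
begin

lemma cond_cdf_deriv:
  assumes "0 < x" "0 < y"
  shows "((\<lambda>x. cond_cdf x y) has_real_derivative exp (- x) * dens (exp_level x) (exp_level y)) (at x)"
proof -
  let ?a = "exp_level x" and ?b = "exp_level y"
  note pos = exp_level_pos[OF assms(1)] exp_level_pos[OF assms(2)]
  note u = exp_cdf_in_unit(1)[OF assms(1)]
  have "exp ?a = 1 / exp_cdf x" using u unfolding exp_level_def by (rule exp_uminus_ln)
  moreover from DERIV_cmult[OF DERIV_chain2[OF survival_deriv[OF pos] exp_level_deriv[OF assms(1)]], of "exp ?b"]
  have "((\<lambda>x. exp ?b * (exp (- L (exp_level x) ?b) * Lb (exp_level x) ?b)) has_real_derivative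
      exp ?b * (- (exp (- L ?a ?b) * (La ?a ?b * Lb ?a ?b + D ?a ?b)) * - (exp (- x) / exp_cdf x))) (at x)" .
  moreover have "exp ?b * (exp (- L z ?b) * Lb z ?b) = exp (?b - L z ?b) * Lb z ?b" for z
    by (simp add: exp_diff exp_minus field_simps)
  ultimately show ?thesis unfolding cond_cdf_def dens_def
    by (simp add: exp_add exp_diff exp_minus divide_inverse mult_ac)
qed

lemma exp_cond_level:
  assumes "0 < x" "0 < y"
  shows "exp (cond_level x y) = 1 / (1 - cond_cdf x y)" "exp (- cond_level x y) = 1 - cond_cdf x y"
  using cond_cdf_lt_1[OF assms] unfolding cond_level_def by (auto simp: exp_uminus_ln)

lemma cond_level_deriv:
  assumes "0 < x" "0 < y"
  shows "((\<lambda>x. cond_level x y) has_real_derivative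
    exp (- x) * dens (exp_level x) (exp_level y) * exp (cond_level x y)) (at x)"
proof -
  have lt: "0 < 1 - cond_cdf x y" using cond_cdf_lt_1[OF assms] by simp
  have "((\<lambda>u. - ln (1 - u)) has_real_derivative 1 / (1 - cond_cdf x y)) (at (cond_cdf x y))"
    using lt by (auto intro!: derivative_eq_intros)
  from DERIV_chain2[OF this cond_cdf_deriv[OF assms]] show ?thesis
    unfolding cond_level_def[abs_def] exp_cond_level(1)[OF assms, unfolded cond_level_def]
    by (simp add: mult.commute)
qed

lemma cond_survival_tendsto:
  assumes y: "0 < y"
  shows "((\<lambda>x. 1 - cond_cdf x y) \<longlongrightarrow> 0) at_top"
proof (rule tendsto_sandwich)
  let ?b = "exp_level y"
  let ?r = "\<lambda>x. exp_level x / (exp_level x + ?b)"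
  note b = exp_level_pos[OF y]
  have pos: "\<forall>\<^sub>F x::real in at_top. 0 < x" by (rule eventually_gt_at_top)
  show "\<forall>\<^sub>F x in at_top. 0 \<le> 1 - cond_cdf x y"
    using pos by eventually_elim (simp add: cond_cdf_lt_1 y less_imp_le)
  show "\<forall>\<^sub>F x in at_top. 1 - cond_cdf x y \<le> K * ?r x powr (2 + s1) + K * exp_level x * ?r x powr (1 + s1)"
    using pos by eventually_elim (rule cond_survival_comparison(2)[OF _ y])
  have "(?r \<longlongrightarrow> 0 / (0 + ?b)) at_top"
    using b by (intro tendsto_intros exp_level_tendsto) auto
  then have r: "(?r \<longlongrightarrow> 0) at_top" by simp
  have r0: "\<forall>\<^sub>F x in at_top. 0 \<le> ?r x"
    using pos
  proof eventually_elim
    case (elim x)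
    then show ?case using exp_level_pos[OF elim] b by (intro divide_nonneg_nonneg add_nonneg_nonneg) auto
  qed
  have "((\<lambda>x. ?r x powr (2 + s1)) \<longlongrightarrow> 0) at_top" "((\<lambda>x. ?r x powr (1 + s1)) \<longlongrightarrow> 0) at_top"
    by (rule tendsto_zero_powrI[OF r tendsto_const r0]; use s1 in simp)+
  then have "((\<lambda>x. K * ?r x powr (2 + s1) + K * exp_level x * ?r x powr (1 + s1)) \<longlongrightarrow> K * 0 + K * 0 * 0) at_top"
    by (intro tendsto_intros exp_level_tendsto)
  then show "((\<lambda>x. K * ?r x powr (2 + s1) + K * exp_level x * ?r x powr (1 + s1)) \<longlongrightarrow> 0) at_top" by simp
qed simp

text \<open>
As \<open>Lb\<close> is homogeneous of degree 0, only the ratio of the two levels matters, and it converges by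
\<open>exp_level_shift_ratio\<close>; the exponential factor tends to 1.
\<close>
lemma cond_level_shift_tendsto:
  "((\<lambda>x. cond_level x (x + s)) \<longlongrightarrow> - ln (1 - Lb (exp s) 1)) at_top"
proof -
  let ?a = "exp_level" and ?b = "\<lambda>x. exp_level (x + s)"
  have pos: "\<forall>\<^sub>F x::real in at_top. 0 < x \<and> 0 < x + s"
    using eventually_gt_at_top[of "max 0 (- s)"] by eventually_elim auto
  have b0: "(?b \<longlongrightarrow> 0) at_top" by (rule filterlim_compose[OF exp_level_tendsto filterlim_shift_at_top])
  have "isCont (\<lambda>z. Lb z 1) (exp s)" by (rule DERIV_isCont[OF Lb_deriv1]) auto
  from isCont_tendsto_compose[OF this exp_level_shift_ratio[of s]]
  have "((\<lambda>x. Lb (?a x / ?b x) 1) \<longlongrightarrow> Lb (exp s) 1) at_top" .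
  then have "((\<lambda>x. exp (?b x - L (?a x) (?b x)) * Lb (?a x / ?b x) 1) \<longlongrightarrow> exp (0 - L 0 0) * Lb (exp s) 1) at_top"
    by (intro tendsto_intros tendsto_L exp_level_tendsto b0)
  then have "((\<lambda>x. exp (?b x - L (?a x) (?b x)) * Lb (?a x / ?b x) 1) \<longlongrightarrow> Lb (exp s) 1) at_top"
    by (simp add: L_0_0)
  then have "((\<lambda>x. cond_cdf x (x + s)) \<longlongrightarrow> Lb (exp s) 1) at_top"
  proof (rule Lim_transform_eventually)
    show "\<forall>\<^sub>F x in at_top. exp (?b x - L (?a x) (?b x)) * Lb (?a x / ?b x) 1 = cond_cdf x (x + s)"
      using pos
    proof eventually_elim
      case (elim x)
      then have b: "0 < ?b x" using exp_level_pos by auto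
      have "Lb (?b x * (?a x / ?b x)) (?b x * 1) = Lb (?a x / ?b x) 1" using b by (rule Lb_homogeneous)
      then show ?case using b unfolding cond_cdf_def by simp
    qed
  qed
  then show ?thesis unfolding cond_level_def using Lb_lt_1[of "exp s" 1] by (intro tendsto_intros) auto
qed

text \<open>
For \<open>s < 0\<close> the conditioning variable \<open>x + s\<close> may be close to 0, where its level is large. This is harmless
because the ratio of the levels is still at most \<open>2 * exp s\<close>, and so is the level of \<open>x\<close>
since \<open>- x < s\<close>. The bound multiplied by \<open>exp (- s)\<close> is integrable at \<open>- \<infinity>\<close>.
\<close>
lemma cond_survival_domination:
  assumes x: "ln 2 \<le> x" and s: "- x < s"
  shows "1 - cond_cdf x (x + s) \<le> 2 * K * 2 powr (2 + s1) * exp ((2 + s1) * s)"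
proof -
  have "0 < ln (2::real)" by simp
  then have x0: "0 < x" using x by linarith
  have xs: "0 < x + s" using s by simp
  define a b where "a = exp_level x" and "b = exp_level (x + s)"
  have ab: "0 < a" "0 < b" using exp_level_pos x0 xs by (auto simp: a_def b_def)
  have a: "a \<le> 2 * exp (- x)" unfolding a_def by (rule exp_level_upper[OF x])
  have b: "exp (- (x + s)) \<le> b" unfolding b_def by (rule exp_level_lower[OF xs])
  have "a / (a + b) \<le> a / b" using ab by (intro divide_left_mono) auto
  also have "\<dots> \<le> (2 * exp (- x)) / exp (- (x + s))" using a b ab by (intro frac_le) auto
  also have "\<dots> = 2 * exp s" using exp_diff[of "- x" "- (x + s)"] by simp
  finally have r: "a / (a + b) \<le> 2 * exp s" .
  have p: "(a / (a + b)) powr (2 + s1) \<le> (2 * exp s) powr (2 + s1)"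
    "(a / (a + b)) powr (1 + s1) \<le> (2 * exp s) powr (1 + s1)"
    using r ab s1 by (auto intro!: powr_mono2)
  have "exp (- x) \<le> exp s" using s by simp
  then have a': "a \<le> 2 * exp s" using a by linarith
  have "(2 * exp s) powr (2 + s1) = (2 * exp s) powr (1 + (1 + s1))" by simp
  also have "\<dots> = 2 * exp s * (2 * exp s) powr (1 + s1)" by (subst powr_add) simp
  finally have e: "(2 * exp s) powr (2 + s1) = 2 * exp s * (2 * exp s) powr (1 + s1)" .
  have "1 - cond_cdf x (x + s) \<le> K * (a / (a + b)) powr (2 + s1) + K * (a * (a / (a + b)) powr (1 + s1))"
    using cond_survival_comparison(2)[OF x0 xs] unfolding a_def b_def by (simp add: mult.assoc)
  also have "\<dots> \<le> K * (2 * exp s) powr (2 + s1) + K * (2 * exp s * (2 * exp s) powr (1 + s1))"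
    using p a' ab K by (intro add_mono mult_left_mono mult_mono) auto
  also have "\<dots> = 2 * K * (2 * exp s) powr (2 + s1)" unfolding e by simp
  also have "\<dots> = 2 * K * 2 powr (2 + s1) * exp ((2 + s1) * s)"
    by (simp add: powr_mult exp_powr_real mult.commute)
  finally show ?thesis .
qed

end

lemma two_sided_exponential_integrable:
  fixes c :: real
  assumes "0 < c"
  shows "integrable lborel (\<lambda>s. exp (- c * \<bar>s\<bar>))"
proof -
  let ?u = "\<lambda>s. indicator {0..} s * exp (- c * s) :: real"
  have "(\<integral>\<^sup>+s. ennreal (exp (- c * s)) * indicator {0..} s \<partial>lborel) = ennreal (0 - - (exp (- c * 0) / c))"
  proof (rule nn_integral_FTC_atLeast)
    show "((\<lambda>s. - (exp (- c * s) / c)) has_real_derivative exp (- c * s)) (at s)" for s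
      using assms by (auto intro!: derivative_eq_intros)
    have "filterlim (\<lambda>s. c * s) at_top at_top"
      using assms by (intro filterlim_tendsto_pos_mult_at_top[OF tendsto_const]) (auto simp: filterlim_ident)
    then have "((\<lambda>s. exp (- (c * s))) \<longlongrightarrow> 0) at_top"
      by (intro filterlim_compose[OF exp_at_bot]) (simp add: filterlim_uminus_at_bot)
    then have "((\<lambda>s. - (exp (- c * s) / c)) \<longlongrightarrow> - (0 / c)) at_top"
      using assms by (intro tendsto_intros) auto
    then show "((\<lambda>s. - (exp (- c * s) / c)) \<longlongrightarrow> 0) at_top" by simp
  qed auto
  also have "(\<lambda>s. ennreal (exp (- c * s)) * indicator {0..} s) = (\<lambda>s. ennreal (?u s))"
    by (auto simp: indicator_def)
  finally have u: "integrable lborel ?u" by (intro integrableI_nonneg) auto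
  have "integrable lborel (\<lambda>s. ?u (0 + (-1) * s))"
    using u by (subst lborel_integrable_real_affine_iff) auto
  then have "integrable lborel (\<lambda>s. ?u s + ?u (- s))" using u by (intro Bochner_Integration.integrable_add) auto
  then show ?thesis
    by (rule Bochner_Integration.integrable_bound) (auto simp: indicator_def)
qed

section \<open>Tail probabilities of the vine\<close>

context vine
begin

lemma f_nonneg: "0 \<le> f x"
proof -
  obtain x1 x2 x3 where x: "x = (x1, x2, x3)" by (cases x)
  show ?thesis
  proof (cases "0 < x1 \<and> 0 < x2 \<and> 0 < x3")
    case True
    then have "0 < P12.dens (exp_level x1) (exp_level x2)" "0 < P23.dens (exp_level x2) (exp_level x3)"
      "0 < P132.dens (P12.cond_level x1 x2) (P32.cond_level x3 x2)"
      by (auto intro!: P12.dens_pos P23.dens_pos P132.dens_pos exp_level_pos P12.cond_level_pos P32.cond_level_pos)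
    then show ?thesis using True by (simp add: x f_eq)
  qed (simp add: x f_eq_0)
qed

text \<open>
The probability that the first variable exceeds \<open>x\<close> and the third one exceeds \<open>z\<close>, given that the second
equals \<open>y\<close>.
\<close>
definition cond_joint_survival :: "real \<Rightarrow> real \<Rightarrow> real \<Rightarrow> real" where
  "cond_joint_survival x y z = exp (- L132 (P12.cond_level x y) (P32.cond_level z y))"

text \<open>
Up to a factor independent of \<open>x\<close>, the derivative of \<open>cond_joint_survival\<close> in \<open>z\<close>: differentiating in \<open>z\<close> and then in
\<open>x\<close> leads from the survival function to the vine density.
\<close>
definition cond_partial :: "real \<Rightarrow> real \<Rightarrow> real \<Rightarrow> real" where
  "cond_partial x y z = exp (- L132 (P12.cond_level x y) (P32.cond_level z y))
     * Lb132 (P12.cond_level x y) (P32.cond_level z y)"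

lemma cond_partial_nonneg:
  "0 < x \<Longrightarrow> 0 < y \<Longrightarrow> 0 < z \<Longrightarrow> 0 \<le> cond_partial x y z"
  unfolding cond_partial_def
  by (intro mult_nonneg_nonneg less_imp_le[OF P132.Lb_pos] P12.cond_level_pos P32.cond_level_pos) auto

lemma cond_joint_survival_le:
  assumes "0 < x" "0 < y" "0 < z"
  shows "cond_joint_survival x y z \<le> 1 - P12.cond_cdf x y" "cond_joint_survival x y z \<le> 1 - P32.cond_cdf z y"
    "cond_partial x y z \<le> 1 - P12.cond_cdf x y"
proof -
  let ?A = "P12.cond_level x y" and ?B = "P32.cond_level z y"
  have A: "exp (- L132 ?A ?B) \<le> exp (- ?A)" using P132.L_ge(1)[of ?A ?B] by simp
  have B: "exp (- L132 ?A ?B) \<le> exp (- ?B)" using P132.L_ge(2)[of ?B ?A] by simp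
  show S: "cond_joint_survival x y z \<le> 1 - P12.cond_cdf x y"
    using A P12.exp_cond_level(2)[of x y] assms by (simp add: cond_joint_survival_def)
  show "cond_joint_survival x y z \<le> 1 - P32.cond_cdf z y"
    using B P32.exp_cond_level(2)[of z y] assms by (simp add: cond_joint_survival_def)
  have "Lb132 ?A ?B \<le> 1"
    using P132.Lb_lt_1[of ?A ?B] P12.cond_level_pos[of x y] P32.cond_level_pos[of z y] assms by simp
  then have "exp (- L132 ?A ?B) * Lb132 ?A ?B \<le> exp (- L132 ?A ?B) * 1" by (intro mult_left_mono) auto
  then show "cond_partial x y z \<le> 1 - P12.cond_cdf x y"
    using S unfolding cond_partial_def cond_joint_survival_def by linarith
qed

lemma cond_partial_deriv:
  assumes "0 < x" "0 < y" "0 < z"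
  shows "((\<lambda>x. - (exp (- y) * (exp (- z) * P23.dens (exp_level y) (exp_level z) * exp (P32.cond_level z y))
      * cond_partial x y z)) has_real_derivative f (x, y, z)) (at x)"
proof -
  let ?A = "P12.cond_level x y" and ?B = "P32.cond_level z y"
  have pos: "0 < ?A" "0 < ?B" using P12.cond_level_pos P32.cond_level_pos assms by auto
  from DERIV_minus[OF DERIV_cmult[OF DERIV_chain2[OF P132.survival_deriv[OF pos] P12.cond_level_deriv[OF assms(1,2)]],
      of "exp (- y) * (exp (- z) * P23.dens (exp_level y) (exp_level z) * exp ?B)"]]
  show ?thesis unfolding cond_partial_def f_eq[OF assms] P132.dens_def
    by (simp add: exp_add exp_diff exp_minus divide_inverse mult_ac)
qed

lemma cond_joint_survival_deriv:
  assumes "0 < x" "0 < y" "0 < z"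
  shows "((\<lambda>z. - (exp (- y) * cond_joint_survival x y z)) has_real_derivative
    exp (- y) * (exp (- z) * P23.dens (exp_level y) (exp_level z) * exp (P32.cond_level z y))
      * cond_partial x y z) (at z)"
proof -
  let ?A = "P12.cond_level x y" and ?B = "P32.cond_level z y"
  have pos: "0 < ?A" "0 < ?B" using P12.cond_level_pos P32.cond_level_pos assms by auto
  from DERIV_chain2[OF P132.L_deriv2[OF pos] P32.cond_level_deriv[OF assms(3,2)]]
  have "((\<lambda>z. L132 ?A (P32.cond_level z y)) has_real_derivative
    Lb132 ?A ?B * (exp (- z) * P23.dens (exp_level y) (exp_level z) * exp ?B)) (at z)"
    by (simp add: P32_dens)
  from DERIV_minus[OF DERIV_cmult[OF DERIV_chain2[OF DERIV_exp DERIV_minus[OF this]], of "exp (- y)"]]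
  show ?thesis unfolding cond_partial_def cond_joint_survival_def by (simp add: mult_ac)
qed

lemma nn_integral_Ioi_eq_Ici:
  fixes a :: real
  shows "(\<integral>\<^sup>+x. F x * indicator {a<..} x \<partial>lborel) = (\<integral>\<^sup>+x. F x * indicator {a..} x \<partial>lborel)"
  by (rule nn_integral_cong_AE)
     (use AE_lborel_singleton[of a] in eventually_elim, auto simp: indicator_def)

end

text \<open>
The first and the third variable are integrated out by Tonelli's theorem, for which the density has to
be jointly measurable.
\<close>
locale measurable_vine = vine +
  assumes f_meas: "f \<in> borel_measurable borel"
begin

lemma f_measurable [measurable]: "f \<in> borel_measurable (borel \<Otimes>\<^sub>M borel \<Otimes>\<^sub>M borel)"
  using f_meas by (simp add: borel_prod)

definition inner_integral :: "real \<Rightarrow> real \<Rightarrow> real \<Rightarrow> ennreal" where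
  "inner_integral x y z = (\<integral>\<^sup>+x'. ennreal (f (x', y, z)) * indicator {x<..} x' \<partial>lborel)"

text \<open>
An application of the fundamental theorem of calculus on a half-line; the boundary
term at infinity vanishes since \<open>cond_partial\<close> is at most the conditional survival function of the
first variable.
\<close>
lemma inner_integral_eq:
  assumes "0 < x" "0 < y" "0 < z"
  shows "inner_integral x y z =
    ennreal (exp (- y) * (exp (- z) * P23.dens (exp_level y) (exp_level z) * exp (P32.cond_level z y)) * cond_partial x y z)"
proof -
  let ?c = "exp (- y) * (exp (- z) * P23.dens (exp_level y) (exp_level z) * exp (P32.cond_level z y))"
  have "inner_integral x y z = ennreal (0 - - (?c * cond_partial x y z))"
    unfolding inner_integral_def nn_integral_Ioi_eq_Ici
  proof (rule nn_integral_FTC_atLeast)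
    show "(\<lambda>x. f (x, y, z)) \<in> borel_measurable borel" by measurable
    show "((\<lambda>x. - (?c * cond_partial x y z)) has_real_derivative f (x', y, z)) (at x')" if "x \<le> x'" for x'
      using cond_partial_deriv[of x' y z] assms that by auto
    have "((\<lambda>x. cond_partial x y z) \<longlongrightarrow> 0) at_top"
    proof (rule tendsto_sandwich[OF _ _ tendsto_const P12.cond_survival_tendsto[OF assms(2)]])
      show "\<forall>\<^sub>F x in at_top. 0 \<le> cond_partial x y z"
        using eventually_gt_at_top[of 0] by eventually_elim (use cond_partial_nonneg assms in auto)
      show "\<forall>\<^sub>F x in at_top. cond_partial x y z \<le> 1 - P12.cond_cdf x y"
        using eventually_gt_at_top[of 0] by eventually_elim (use cond_joint_survival_le(3) assms in auto)
    qed
    then have "((\<lambda>x. - (?c * cond_partial x y z)) \<longlongrightarrow> - (?c * 0)) at_top" by (intro tendsto_intros)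
    then show "((\<lambda>x. - (?c * cond_partial x y z)) \<longlongrightarrow> 0) at_top" by simp
  qed (rule f_nonneg)
  then show ?thesis by simp
qed

definition slice_integral :: "real \<Rightarrow> real \<Rightarrow> ennreal" where
  "slice_integral x y = (\<integral>\<^sup>+z. inner_integral x y z * indicator {x<..} z \<partial>lborel)"

lemma inner_integral_measurable [measurable]:
  "(\<lambda>(y, z). inner_integral x y z) \<in> borel_measurable (borel \<Otimes>\<^sub>M borel)"
  unfolding inner_integral_def by measurable

lemma slice_integral_measurable [measurable]: "slice_integral x \<in> borel_measurable borel"
  unfolding slice_integral_def by measurable

lemma slice_integral_eq:
  assumes "0 < x"
  shows "slice_integral x y = ennreal (if 0 < y then exp (- y) * cond_joint_survival x y x else 0)"
proof (cases "0 < y")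
  case y: True
  have "slice_integral x y = (\<integral>\<^sup>+z. ennreal (enn2real (inner_integral x y z)) * indicator {x..} z \<partial>lborel)"
    unfolding slice_integral_def nn_integral_Ioi_eq_Ici
    by (rule nn_integral_cong) (use assms y in \<open>auto simp: indicator_def inner_integral_eq\<close>)
  also have "\<dots> = ennreal (0 - - (exp (- y) * cond_joint_survival x y x))"
  proof (rule nn_integral_FTC_atLeast[where F="\<lambda>z. - (exp (- y) * cond_joint_survival x y z)"])
    show "(\<lambda>z. enn2real (inner_integral x y z)) \<in> borel_measurable borel" by measurable
    show "((\<lambda>z. - (exp (- y) * cond_joint_survival x y z)) has_real_derivative enn2real (inner_integral x y z)) (at z)"
      if "x \<le> z" for z
    proof -
      have z: "0 < z" using assms that by simp
      have "0 \<le> exp (- y) * (exp (- z) * P23.dens (exp_level y) (exp_level z) * exp (P32.cond_level z y)) * cond_partial x y z"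
        using P23.dens_pos[of "exp_level y" "exp_level z"] exp_level_pos cond_partial_nonneg[of x y z] assms y z
        by (intro mult_nonneg_nonneg) auto
      then show ?thesis
        using cond_joint_survival_deriv[OF assms y z] unfolding inner_integral_eq[OF assms y z] by simp
    qed
    have "((\<lambda>z. cond_joint_survival x y z) \<longlongrightarrow> 0) at_top"
    proof (rule tendsto_sandwich[OF _ _ tendsto_const P32.cond_survival_tendsto[OF y]])
      show "\<forall>\<^sub>F z in at_top. 0 \<le> cond_joint_survival x y z" by (simp add: cond_joint_survival_def)
      show "\<forall>\<^sub>F z in at_top. cond_joint_survival x y z \<le> 1 - P32.cond_cdf z y"
        using eventually_gt_at_top[of 0] by eventually_elim (use cond_joint_survival_le(2) assms y in auto)
    qed
    then have "((\<lambda>z. - (exp (- y) * cond_joint_survival x y z)) \<longlongrightarrow> - (exp (- y) * 0)) at_top"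
      by (intro tendsto_intros)
    then show "((\<lambda>z. - (exp (- y) * cond_joint_survival x y z)) \<longlongrightarrow> 0) at_top" by simp
  qed simp
  finally show ?thesis using y by simp
next
  case False
  then have "inner_integral x y z = 0" for z
    unfolding inner_integral_def by (simp add: f_eq_0)
  then show ?thesis using False by (simp add: slice_integral_def)
qed

lemma nn_integral_orthant:
  assumes [measurable]: "E \<in> sets borel"
  shows "(\<integral>\<^sup>+v. ennreal (f v) * indicator ({x<..} \<times> (E \<times> {x<..})) v \<partial>lborel) =
    (\<integral>\<^sup>+y. slice_integral x y * indicator E y \<partial>lborel)"
proof -
  have meas: "(\<lambda>v. ennreal (f v) * indicator ({x<..} \<times> (E \<times> {x<..})) v)
      \<in> borel_measurable (borel \<Otimes>\<^sub>M (borel \<Otimes>\<^sub>M borel))"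
    by measurable
  have "(\<integral>\<^sup>+v. ennreal (f v) * indicator ({x<..} \<times> (E \<times> {x<..})) v \<partial>lborel) =
      (\<integral>\<^sup>+v. ennreal (f v) * indicator ({x<..} \<times> (E \<times> {x<..})) v \<partial>(lborel \<Otimes>\<^sub>M (lborel :: (real \<times> real) measure)))"
    by (simp only: lborel_prod)
  also have "\<dots> = (\<integral>\<^sup>+w. (\<integral>\<^sup>+x'. ennreal (f (x', w)) * indicator ({x<..} \<times> (E \<times> {x<..})) (x', w) \<partial>lborel) \<partial>lborel)"
    by (rule lborel_pair.nn_integral_snd[symmetric]) (use meas in \<open>simp add: borel_prod lborel_prod\<close>)
  also have "\<dots> = (\<integral>\<^sup>+w. (\<integral>\<^sup>+x'. ennreal (f (x', w)) * indicator ({x<..} \<times> (E \<times> {x<..})) (x', w) \<partial>lborel) \<partial>(lborel \<Otimes>\<^sub>M lborel))"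
    by (simp only: lborel_prod)
  also have "\<dots> = (\<integral>\<^sup>+y. (\<integral>\<^sup>+z. (\<integral>\<^sup>+x'. ennreal (f (x', y, z)) * indicator ({x<..} \<times> (E \<times> {x<..})) (x', y, z) \<partial>lborel) \<partial>lborel) \<partial>lborel)"
    by (subst lborel.nn_integral_fst[symmetric]) auto
  also have "\<dots> = (\<integral>\<^sup>+y. (\<integral>\<^sup>+z. inner_integral x y z * indicator {x<..} z * indicator E y \<partial>lborel) \<partial>lborel)"
    unfolding inner_integral_def
    by (subst nn_integral_multc[symmetric], simp)+
       (auto intro!: nn_integral_cong simp: indicator_def)
  also have "\<dots> = (\<integral>\<^sup>+y. slice_integral x y * indicator E y \<partial>lborel)"
    unfolding slice_integral_def by (subst nn_integral_multc) auto
  finally show ?thesis .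
qed

text \<open>
The contribution of the second variable at \<open>x + s\<close> to the probability that the first and the third variable exceed
\<open>x\<close>, rescaled by \<open>exp x\<close>.
\<close>
definition slice_density :: "real \<Rightarrow> real \<Rightarrow> real" where
  "slice_density x s = exp x * enn2real (slice_integral x (x + s))"

lemma slice_density_measurable [measurable]: "slice_density x \<in> borel_measurable borel"
  unfolding slice_density_def[abs_def] by measurable

lemma slice_density_eq:
  assumes "0 < x"
  shows "slice_density x s = (if - x < s then exp (- s) * cond_joint_survival x (x + s) x else 0)"
proof -
  have "exp x * (exp (- (x + s)) * c) = exp (- s) * c" for c
    by (simp add: exp_add exp_diff exp_minus field_simps)
  then show ?thesis unfolding slice_density_def slice_integral_eq[OF assms]
    by (auto simp: cond_joint_survival_def)
qed

text \<open>
The pointwise limit of \<open>slice_density\<close> in \<open>x\<close>. The function \<open>La23\<close> with its arguments exchanged is the \<open>Lb\<close> of the flipped pair.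
\<close>
definition limit_density :: "real \<Rightarrow> real" where
  "limit_density s = exp (- s) * exp (- L132 (- ln (1 - Lb12 (exp s) 1)) (- ln (1 - La23 1 (exp s))))"

lemma slice_density_tendsto: "((\<lambda>x. slice_density x s) \<longlongrightarrow> limit_density s) at_top"
proof -
  have "((\<lambda>x. exp (- s) * cond_joint_survival x (x + s) x) \<longlongrightarrow> limit_density s) at_top"
    unfolding cond_joint_survival_def limit_density_def
    by (intro tendsto_intros P132.tendsto_L P12.cond_level_shift_tendsto P32.cond_level_shift_tendsto)
  then show ?thesis
  proof (rule Lim_transform_eventually)
    show "\<forall>\<^sub>F x in at_top. exp (- s) * cond_joint_survival x (x + s) x = slice_density x s"
      using eventually_gt_at_top[of "max 0 (- s)"] by eventually_elim (auto simp: slice_density_eq)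
  qed
qed

text \<open>
For \<open>s \<ge> 0\<close> the marginal factor \<open>exp (- s)\<close> suffices. For \<open>s < 0\<close> that factor grows, but
the first variable then has to exceed the second by \<open>- s\<close>, which compensates it.
\<close>
lemma slice_density_bound:
  "\<exists>C c. 0 < c \<and> (\<forall>x s. ln 2 \<le> x \<longrightarrow> \<bar>slice_density x s\<bar> \<le> C * exp (- c * \<bar>s\<bar>))"
proof -
  define c where "c = min 1 (1 + s1_12)"
  define C where "C = 1 + 2 * K12 * 2 powr (2 + s1_12)"
  have c: "0 < c" "c \<le> 1" "c \<le> 1 + s1_12" using P12.s1 by (auto simp: c_def)
  have C0: "0 \<le> 2 * K12 * 2 powr (2 + s1_12)" using P12.K by simp
  then have C: "1 \<le> C" "2 * K12 * 2 powr (2 + s1_12) \<le> C" by (auto simp: C_def)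
  have "\<bar>slice_density x s\<bar> \<le> C * exp (- c * \<bar>s\<bar>)" if x: "ln 2 \<le> x" for x s
  proof -
    have "0 < ln (2::real)" by simp
    then have x0: "0 < x" using x by linarith
    show ?thesis
    proof (cases "- x < s")
      case s: True
      have xs: "0 < x + s" using s by simp
      have abs: "\<bar>slice_density x s\<bar> = exp (- s) * cond_joint_survival x (x + s) x"
        using s by (simp add: slice_density_eq[OF x0] cond_joint_survival_def)
      have S: "cond_joint_survival x (x + s) x \<le> 1 - P12.cond_cdf x (x + s)"
        by (rule cond_joint_survival_le(1)[OF x0 xs x0])
      show ?thesis
      proof (cases "0 \<le> s")
        case True
        have "cond_joint_survival x (x + s) x \<le> 1" using S P12.cond_cdf_pos[OF x0 xs] by simp
        then have "exp (- s) * cond_joint_survival x (x + s) x \<le> exp (- s) * 1" by (intro mult_left_mono) auto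
        also have "\<dots> \<le> exp (- c * \<bar>s\<bar>)" using True c mult_right_mono[of c 1 s] by simp
        also have "\<dots> \<le> C * exp (- c * \<bar>s\<bar>)" using C by (simp add: mult_le_cancel_right1)
        finally show ?thesis unfolding abs .
      next
        case False
        have "exp (- s) * cond_joint_survival x (x + s) x \<le>
            exp (- s) * (2 * K12 * 2 powr (2 + s1_12) * exp ((2 + s1_12) * s))"
          using S P12.cond_survival_domination[OF x s] by (intro mult_left_mono) auto
        also have "\<dots> = 2 * K12 * 2 powr (2 + s1_12) * (exp (- s) * exp ((2 + s1_12) * s))" by simp
        also have "exp (- s) * exp ((2 + s1_12) * s) = exp ((1 + s1_12) * s)"
          unfolding exp_add[symmetric] by (simp add: algebra_simps)
        also have "2 * K12 * 2 powr (2 + s1_12) * exp ((1 + s1_12) * s) \<le> C * exp (- c * \<bar>s\<bar>)"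
        proof (intro mult_mono C)
          have "(1 + s1_12) * s \<le> c * s" using c False by (intro mult_right_mono_neg) auto
          then show "exp ((1 + s1_12) * s) \<le> exp (- c * \<bar>s\<bar>)" using False by simp
        qed (use C in auto)
        finally show ?thesis unfolding abs .
      qed
    next
      case False
      then show ?thesis using C by (simp add: slice_density_eq[OF x0])
    qed
  qed
  then show ?thesis using c by blast
qed

text \<open>
The set \<open>E\<close> is the range allowed for the second variable relative to \<open>x\<close>: the positive half-line when the second
variable has to exceed \<open>x\<close> as well, and the whole line when it is unrestricted.
\<close>
lemma tail_integral_tendsto:
  assumes [measurable]: "E \<in> sets borel" and E: "{0<..} \<subseteq> E"
  shows "\<exists>\<kappa>>0. ((\<lambda>x. \<integral>s. slice_density x s * indicator E s \<partial>lborel) \<longlongrightarrow> \<kappa>) at_top"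
proof -
  obtain C c where c: "0 < c" and bound: "\<And>x s. ln 2 \<le> x \<Longrightarrow> \<bar>slice_density x s\<bar> \<le> C * exp (- c * \<bar>s\<bar>)"
    using slice_density_bound by blast
  let ?w = "\<lambda>s. C * exp (- c * \<bar>s\<bar>)"
  have w: "integrable lborel ?w"
    using two_sided_exponential_integrable[OF c] by (intro integrable_mult_right) auto
  have [measurable]: "limit_density \<in> borel_measurable borel"
  proof (rule borel_measurable_LIMSEQ_real)
    show "(\<lambda>n. slice_density (real n) s) \<longlonglongrightarrow> limit_density s" for s
      by (rule filterlim_compose[OF slice_density_tendsto filterlim_real_sequentially])
  qed measurable
  have bd: "\<forall>\<^sub>F x in at_top. AE s in lborel. norm (slice_density x s * indicator E s) \<le> ?w s"
    using eventually_ge_at_top[of "ln 2"]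
  proof eventually_elim
    case (elim x)
    have "norm (slice_density x s * indicator E s) \<le> ?w s" for s
      using bound[OF elim, of s] by (auto simp: indicator_def)
    then show ?case by simp
  qed
  have lim: "AE s in lborel. ((\<lambda>x. slice_density x s * indicator E s) \<longlongrightarrow> limit_density s * indicator E s) at_top"
    by (intro AE_I2 tendsto_mult slice_density_tendsto tendsto_const)
  let ?\<kappa> = "\<integral>s. limit_density s * indicator E s \<partial>lborel"
  have conv: "((\<lambda>x. \<integral>s. slice_density x s * indicator E s \<partial>lborel) \<longlongrightarrow> ?\<kappa>) at_top"
    by (rule integral_dominated_convergence_at_top[OF _ _ w lim bd]) measurable
  have int: "integrable lborel (\<lambda>s. limit_density s * indicator E s)"
    by (rule integrable_dominated_convergence_at_top[OF _ _ w lim bd]) measurable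
  have nn: "0 \<le> limit_density s * indicator E s" for s by (simp add: limit_density_def)
  have "?\<kappa> \<noteq> 0"
  proof
    assume "?\<kappa> = 0"
    then have "AE s in lborel. limit_density s * indicator E s = 0"
      using integral_nonneg_eq_0_iff_AE[OF int] nn by auto
    then have "AE s in lborel. s \<notin> {0<..<1::real}"
      by eventually_elim (use E in \<open>auto simp: limit_density_def indicator_def split: if_splits\<close>)
    moreover have "{s \<in> space lborel. \<not> s \<notin> {0<..<1::real}} = {0<..<1}" by auto
    ultimately have "emeasure lborel {0<..<1::real} = 0"
      using AE_iff_measurable[of "{0<..<1::real}" lborel "\<lambda>s. s \<notin> {0<..<1}"] by auto
    then show False by (simp add: emeasure_lborel_Ioo)
  qed
  moreover have "0 \<le> ?\<kappa>" using nn by (intro integral_nonneg_AE) auto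
  ultimately have "0 < ?\<kappa>" by simp
  with conv show ?thesis by blast
qed

lemma orthant_integral_eq:
  assumes [measurable]: "E \<in> sets borel" and x: "0 < x"
  shows "(\<integral>\<^sup>+v. ennreal (f v) * indicator ({x<..} \<times> ({y. y - x \<in> E} \<times> {x<..})) v \<partial>lborel) =
    ennreal (exp (- x)) * (\<integral>\<^sup>+s. ennreal (slice_density x s * indicator E s) \<partial>lborel)"
proof -
  have [measurable]: "{y. y - x \<in> E} \<in> sets borel" by measurable
  have "(\<integral>\<^sup>+v. ennreal (f v) * indicator ({x<..} \<times> ({y. y - x \<in> E} \<times> {x<..})) v \<partial>lborel) =
      (\<integral>\<^sup>+y. slice_integral x y * indicator {y. y - x \<in> E} y \<partial>lborel)"
    by (rule nn_integral_orthant) measurable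
  also have "\<dots> = (\<integral>\<^sup>+s. slice_integral x (x + 1 * s) * indicator {y. y - x \<in> E} (x + 1 * s) \<partial>lborel)"
    by (subst nn_integral_real_affine[where c=1 and t=x]) auto
  also have "\<dots> = (\<integral>\<^sup>+s. ennreal (exp (- x)) * ennreal (slice_density x s * indicator E s) \<partial>lborel)"
  proof (rule nn_integral_cong)
    fix s
    have "slice_integral x (x + s) = ennreal (enn2real (slice_integral x (x + s)))"
      using slice_integral_eq[OF x, of "x + s"] by (simp add: cond_joint_survival_def)
    also have "\<dots> = ennreal (exp (- x) * slice_density x s)"
      by (simp add: slice_density_def exp_minus)
    also have "\<dots> = ennreal (exp (- x)) * ennreal (slice_density x s)"
      by (rule ennreal_mult') simp
    finally show "slice_integral x (x + 1 * s) * indicator {y. y - x \<in> E} (x + 1 * s) =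
        ennreal (exp (- x)) * ennreal (slice_density x s * indicator E s)"
      by (auto simp: indicator_def)
  qed
  also have "\<dots> = ennreal (exp (- x)) * (\<integral>\<^sup>+s. ennreal (slice_density x s * indicator E s) \<partial>lborel)"
    by (rule nn_integral_cmult) measurable
  finally show ?thesis .
qed

text \<open>
The hypothesis on \<open>I\<close> lets the index sets \<open>{1, 2, 3}\<close> and \<open>{1, 3}\<close> be treated together. A slowly varying
function is provided by the positive limit of \<open>exp x\<close> times the probability.
\<close>
lemma tail_probability_asymptotics:
  fixes M :: "'a measure" and X :: "nat \<Rightarrow> 'a \<Rightarrow> real"
  assumes "prob_space M"
    and joint: "distributed M lborel (\<lambda>\<omega>. (X 1 \<omega>, X 2 \<omega>, X 3 \<omega>)) (\<lambda>x. ennreal (f x))"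
    and E: "E \<in> sets borel" "{0<..} \<subseteq> E"
    and I: "\<And>x \<omega>. (\<forall>i\<in>I. X i \<omega> > x) \<longleftrightarrow> X 1 \<omega> > x \<and> X 2 \<omega> - x \<in> E \<and> X 3 \<omega> > x"
  shows "is_tail_dependence_coeff M X I 1"
proof -
  note [measurable] = E(1)
  obtain \<kappa> where \<kappa>: "0 < \<kappa>" and lim: "((\<lambda>x. \<integral>s. slice_density x s * indicator E s \<partial>lborel) \<longlongrightarrow> \<kappa>) at_top"
    using tail_integral_tendsto[OF E] by blast
  let ?p = "\<lambda>x. measure M {\<omega> \<in> space M. \<forall>i\<in>I. X i \<omega> > x}"
  have p: "?p x = exp (- x) * (\<integral>s. slice_density x s * indicator E s \<partial>lborel)" if x: "0 < x" for x
  proof -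
    let ?A = "{x<..} \<times> ({y. y - x \<in> E} \<times> {x<..})"
    have "?A \<in> sets (borel \<Otimes>\<^sub>M (borel \<Otimes>\<^sub>M borel))" by measurable
    then have A: "?A \<in> sets lborel" by (simp only: borel_prod sets_lborel)
    have "{\<omega> \<in> space M. \<forall>i\<in>I. X i \<omega> > x} = (\<lambda>\<omega>. (X 1 \<omega>, X 2 \<omega>, X 3 \<omega>)) -` ?A \<inter> space M"
      unfolding I by auto
    then have "emeasure M {\<omega> \<in> space M. \<forall>i\<in>I. X i \<omega> > x} = (\<integral>\<^sup>+v. ennreal (f v) * indicator ?A v \<partial>lborel)"
      using distributed_emeasure[OF joint A] by simp
    also have "\<dots> = ennreal (exp (- x)) * (\<integral>\<^sup>+s. ennreal (slice_density x s * indicator E s) \<partial>lborel)"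
      by (rule orthant_integral_eq[OF E(1) x])
    finally have "?p x = exp (- x) * enn2real (\<integral>\<^sup>+s. ennreal (slice_density x s * indicator E s) \<partial>lborel)"
      unfolding measure_def by (simp add: enn2real_mult)
    also have "enn2real (\<integral>\<^sup>+s. ennreal (slice_density x s * indicator E s) \<partial>lborel)
        = (\<integral>s. slice_density x s * indicator E s \<partial>lborel)"
      by (rule integral_eq_nn_integral[symmetric]) (auto simp: slice_density_def)
    finally show ?thesis .
  qed
  have "((\<lambda>x. (\<integral>s. slice_density x s * indicator E s \<partial>lborel) / \<kappa>) \<longlongrightarrow> \<kappa> / \<kappa>) at_top"
    using \<kappa> by (intro tendsto_intros lim) auto
  then have "((\<lambda>x. (\<integral>s. slice_density x s * indicator E s \<partial>lborel) / \<kappa>) \<longlongrightarrow> 1) at_top"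
    using \<kappa> by simp
  then have "((\<lambda>x. ?p x / (\<kappa> * exp (- x / 1))) \<longlongrightarrow> 1) at_top"
  proof (rule Lim_transform_eventually)
    show "\<forall>\<^sub>F x in at_top. (\<integral>s. slice_density x s * indicator E s \<partial>lborel) / \<kappa> = ?p x / (\<kappa> * exp (- x / 1))"
      using eventually_gt_at_top[of 0] by eventually_elim (use \<kappa> in \<open>simp add: p\<close>)
  qed
  then have "?p \<sim>[at_top] (\<lambda>x. \<kappa> * exp (- x / 1))" by (rule asymp_equivI')
  moreover have "slowly_varying (\<lambda>_. \<kappa>)" using \<kappa> by (simp add: slowly_varying_def)
  ultimately show ?thesis unfolding is_tail_dependence_coeff_def
    by (intro conjI exI[of _ "\<lambda>_. \<kappa>"]) auto
qed

end

section \<open>The gauge function and the coefficients of tail dependence\<close>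

theorem mainTheorem12:
  fixes M :: "'a measure" and X :: "nat \<Rightarrow> 'a \<Rightarrow> real"
    and H12 H23 H132 :: "real measure" and h12 h23 h132 :: "real \<Rightarrow> real"
    and c1_12 s1_12 c2_12 s2_12 c1_23 s1_23 c2_23 s2_23 c1_132 s1_132 c2_132 s2_132 :: real
    and V12 V23 V132 :: "real \<Rightarrow> real \<Rightarrow> real"
    and f :: "real \<times> real \<times> real \<Rightarrow> real"
  assumes "V12 = exponent_measure H12"
    and "V23 = exponent_measure H23"
    and "V132 = exponent_measure H132"
    and "f = vine_density (ev_copula V12) (ev_copula V23) (inverted_ev_copula V132)"
    and "spectral_distribution H12" "spectral_distribution H23" "spectral_distribution H132"
    and "has_partial_derivs V12" "has_partial_derivs V23" "has_partial_derivs V132"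
    and "spectral_density H12 h12" "spectral_density H23 h23" "spectral_density H132 h132"
    and "spectral_tails h12 c1_12 s1_12 c2_12 s2_12"
    and "spectral_tails h23 c1_23 s1_23 c2_23 s2_23"
    and "spectral_tails h132 c1_132 s1_132 c2_132 s2_132"
    and "locally_bounded_positive h12" "locally_bounded_positive h23"
      "locally_bounded_positive h132"
    and "prob_space M"
    and "\<And>i. i \<in> {1, 2, 3} \<Longrightarrow> distributed M lborel (X i) (\<lambda>x. ennreal (exponential_density 1 x))"
    and "distributed M lborel (\<lambda>\<omega>. (X 1 \<omega>, X 2 \<omega>, X 3 \<omega>)) (\<lambda>x. ennreal (f x))"
  shows "(\<exists>g. is_gauge_function f g \<and>
    (\<forall>x1 x2 x3. min x1 (min x2 x3) \<ge> 0 \<longrightarrow>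
      (max x1 x3 < x2 \<longrightarrow>
         (let a = (1 + s2_12) * (x2 - x1);
              b = (1 + s1_23) * (x2 - x3);
              sm = (if a \<ge> b then s1_132 else s2_132)
          in g (x1, x2, x3) = x2 + (2 + sm) * max a b - (1 + sm) * min a b)) \<and>
      (x1 < x2 \<and> x2 \<le> x3 \<longrightarrow>
         g (x1, x2, x3) =
           x2 + (2 + s1_132) * (1 + s2_12) * (x2 - x1) + (2 + s2_23) * (x3 - x2)) \<and>
      (x3 < x2 \<and> x2 \<le> x1 \<longrightarrow>
         g (x1, x2, x3) =
           x2 + (2 + s2_132) * (1 + s1_23) * (x2 - x3) + (2 + s1_12) * (x1 - x2)) \<and>
      (x2 \<le> min x1 x3 \<longrightarrow>
         g (x1, x2, x3) =
           x2 + V132 (inverse ((2 + s1_12) * (x1 - x2))) (inverse ((2 + s2_23) * (x3 - x2)))))) \<and>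
    is_tail_dependence_coeff M X {1, 2, 3} 1 \<and>
    is_tail_dependence_coeff M X {1, 3} 1"
proof -
  interpret S12: spectral_model H12 h12 c1_12 s1_12 c2_12 s2_12
    using assms by unfold_locales auto
  interpret S23: spectral_model H23 h23 c1_23 s1_23 c2_23 s2_23
    using assms by unfold_locales auto
  interpret S132: spectral_model H132 h132 c1_132 s1_132 c2_132 s2_132
    using assms by unfold_locales auto
  obtain K12 where K12: "stdf S12.L (\<lambda>a b. S12.G1 (b / (a + b))) (\<lambda>a b. S12.G (b / (a + b))) S12.D s1_12 s2_12 K12"
    using S12.stdf_exists by blast
  obtain K23 where K23: "stdf S23.L (\<lambda>a b. S23.G1 (b / (a + b))) (\<lambda>a b. S23.G (b / (a + b))) S23.D s1_23 s2_23 K23"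
    using S23.stdf_exists by blast
  obtain K132 where K132: "stdf S132.L (\<lambda>a b. S132.G1 (b / (a + b))) (\<lambda>a b. S132.G (b / (a + b))) S132.D
      s1_132 s2_132 K132"
    using S132.stdf_exists by blast
  interpret vn: vine
    S12.L "\<lambda>a b. S12.G1 (b / (a + b))" "\<lambda>a b. S12.G (b / (a + b))" S12.D s1_12 s2_12 K12
    S23.L "\<lambda>a b. S23.G1 (b / (a + b))" "\<lambda>a b. S23.G (b / (a + b))" S23.D s1_23 s2_23 K23
    S132.L "\<lambda>a b. S132.G1 (b / (a + b))" "\<lambda>a b. S132.G (b / (a + b))" S132.D s1_132 s2_132 K132
    by (intro vine.intro K12 K23 K132)
  have V: "vn.P12.V = V12" "vn.P23.V = V23" "vn.P132.V = V132"
    unfolding vn.P12.V_def[abs_def] vn.P23.V_def[abs_def] vn.P132.V_def[abs_def] assms(1-3)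
    by (simp_all add: S12.V_eq S23.V_eq S132.V_eq fun_eq_iff)
  have f: "vn.f = f" unfolding vn.f_def V assms(4) ..
  have joint: "distributed M lborel (\<lambda>\<omega>. (X 1 \<omega>, X 2 \<omega>, X 3 \<omega>)) (\<lambda>x. ennreal (vn.f x))"
    unfolding f by fact
  have "(\<lambda>x. ennreal (vn.f x)) \<in> borel_measurable borel"
    using distributed_borel_measurable[OF joint] by (simp only: measurable_lborel1 measurable_lborel2)
  then have "(\<lambda>x. enn2real (ennreal (vn.f x))) \<in> borel_measurable borel"
    by (rule borel_measurable_enn2real)
  then have meas: "vn.f \<in> borel_measurable borel" by (simp only: enn2real_ennreal vn.f_nonneg)
  \<comment> \<open>The density is measurable as the joint density of the three variables.\<close>
  interpret mv: measurable_vine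
    S12.L "\<lambda>a b. S12.G1 (b / (a + b))" "\<lambda>a b. S12.G (b / (a + b))" S12.D s1_12 s2_12 K12
    S23.L "\<lambda>a b. S23.G1 (b / (a + b))" "\<lambda>a b. S23.G (b / (a + b))" S23.D s1_23 s2_23 K23
    S132.L "\<lambda>a b. S132.G1 (b / (a + b))" "\<lambda>a b. S132.G (b / (a + b))" S132.D s1_132 s2_132 K132
    by unfold_locales (rule meas)
  have "is_tail_dependence_coeff M X {1, 2, 3} 1"
    by (rule mv.tail_probability_asymptotics[OF \<open>prob_space M\<close> joint, of "{0<..}"]) auto
  moreover have "is_tail_dependence_coeff M X {1, 3} 1"
    by (rule mv.tail_probability_asymptotics[OF \<open>prob_space M\<close> joint, of UNIV]) auto
  moreover have "is_gauge_function f vn.gauge" using vn.is_gauge_function_gauge unfolding f .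
  moreover have "V132 (inverse a) (inverse b) = S132.L a b" for a b
    by (simp only: assms(3) S132.V_eq inverse_inverse_eq)
  ultimately show ?thesis
    unfolding Let_def
    by (intro conjI exI[of _ vn.gauge] allI impI; (elim conjE)?)
       (simp_all only: vn.gauge_cases min.bounded_iff)
qed

end
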